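(* Let $\Gamma=\mathrm{PSL}_2(\mathbb Z)$ and $\rho=e^{\pi i/3}$, and use the notation of the context. The map $\varphi:\mathcal D_\rho\to\mathcal R^{\mathrm{prim}}$ given by $$\varphi(B_0,C_0)=\left\{\begin{pmatrix}\frac T2-k(B_0-C_0) & kB_0\\ kC_0 & \frac T2+k(B_0-C_0)\end{pmatrix}\right\},$$ where $\Delta=B_0^2+C_0^2-B_0C_0$ and $(T,k)$ is the smallest positive integer solution of $T^2-4k^2\Delta=4$, is well defined and surjective. Moreover, for each $\Delta\in D_\rho$, denoting by $\mathcal R^{\mathrm{prim}}_\Delta$ the image of $\mathcal D_\Delta$ under $\varphi$, the restriction $\varphi:\mathcal D_\Delta\to\mathcal R^{\mathrm{prim}}_\Delta$ is - 1-to-1 if $\Delta\in D_\rho^{1,1}$; - 2-to-1 if $\Delta\in D_\rho^{1,0}$ or $\Delta\in D_\rho^{0,1}$; - 4-to-1 if $\Delta\in D_\rho^{0,0}$ (that is, every fibre has exactly 1, 2, respectively 4 elements).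
   Context: For a hyperbolic $g\in\Gamma$, its axis is the geodesic in the upper half plane $\mathbb H$ joining the two real fixed points of $g$, and $\{g\}$ denotes its conjugacy class in $\Gamma$. $g$ is primitive if it is not a proper power $h^n$, $n\geq 2$, of an element $h\in\Gamma$. $\mathcal R$ is the set of conjugacy classes of hyperbolic elements of $\Gamma$ containing an element whose axis passes through $\rho$, and $\mathcal R^{\mathrm{prim}}\subseteq\mathcal R$ is the subset of classes of primitive elements (these correspond to the primitive closed geodesics on $\mathbb H/\Gamma$ through the image of $\rho$). $\mathcal D_\rho$ is the set of pairs of coprime positive integers $(B_0,C_0)$ such that $\Delta=B_0^2+C_0^2-B_0C_0$ is not a perfect square. $D_\rho$ is the set of values $\Delta$ so obtained, and for $\Delta\in D_\rho$, $\mathcal D_\Delta$ is the (finite) set of $(B_0,C_0)\in\mathcal D_\rho$ with $B_0^2+C_0^2-B_0C_0=\Delta$. For $\epsilon_1,\epsilon_2\in\{0,1\}$, $D_\rho^{\epsilon_1,\epsilon_2}$ is the set of $\Delta\in D_\rho$ such that: the minimal positive integer solution $(T,k)$ of $T^2-4k^2\Delta=4$ has $k$ even if $\epsilon_1=0$ and $k$ odd if $\epsilon_1=1$; and the equation $t^2-4u^2\Delta=9$ has an integer solution $(t,u)$ with $\gcd(3,u)=1$ if $\epsilon_2=0$, and has no such solution if $\epsilon_2=1$. *)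

theory Defs
  imports "HOL-Analysis.Analysis" "HOL-Algebra.Coset" "HOL-Computational_Algebra.Nth_Powers"
begin

section \<open>The modular group\<close>

definition mat2 :: "int \<Rightarrow> int \<Rightarrow> int \<Rightarrow> int \<Rightarrow> int^2^2" where
  "mat2 a b c d = vector [vector [a, b], vector [c, d]]"

definition SL2Z :: "(int^2^2) monoid" where
  "SL2Z = \<lparr>carrier = {A. det A = 1}, mult = (**), one = mat 1\<rparr>"

definition SL2Z_center :: "(int^2^2) set" where
  "SL2Z_center = {mat 1, - mat 1}"

text \<open>Elements of the quotient group are cosets, i.e. pairs of opposite matrices.\<close>

definition PSL2Z :: "(int^2^2) set monoid" where
  "PSL2Z = SL2Z Mod SL2Z_center"

definition to_PSL2Z :: "int^2^2 \<Rightarrow> (int^2^2) set" where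
  "to_PSL2Z A = SL2Z_center #>\<^bsub>SL2Z\<^esub> A"

definition conj_class :: "('a, 'b) monoid_scheme \<Rightarrow> 'a \<Rightarrow> 'a set" where
  "conj_class G g = {x \<otimes>\<^bsub>G\<^esub> g \<otimes>\<^bsub>G\<^esub> inv\<^bsub>G\<^esub> x | x. x \<in> carrier G}"

definition primitive_elt :: "('a, 'b) monoid_scheme \<Rightarrow> 'a \<Rightarrow> bool" where
  "primitive_elt G g \<longleftrightarrow>
     g \<in> carrier G \<and> \<not> (\<exists>h\<in>carrier G. \<exists>n::nat. 2 \<le> n \<and> g = h [^]\<^bsub>G\<^esub> n)"

lemma mat2_nth [simp]:
  "mat2 a b c d $ 1 $ 1 = a" "mat2 a b c d $ 1 $ 2 = b"
  "mat2 a b c d $ 2 $ 1 = c" "mat2 a b c d $ 2 $ 2 = d"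
  by (simp_all add: mat2_def)

lemma group_SL2Z: "group SL2Z"
proof (rule groupI)
  fix A assume "A \<in> carrier SL2Z"
  then have d: "A$1$1 * A$2$2 - A$1$2 * A$2$1 = 1"
    by (simp add: SL2Z_def det_2)
  let ?B = "mat2 (A$2$2) (- A$1$2) (- A$2$1) (A$1$1)"
  have "det ?B = 1" using d by (simp add: det_2 algebra_simps)
  moreover have "?B ** A = mat 1"
    using d by (simp add: vec_eq_iff forall_2 matrix_matrix_mult_def sum_2 mat_def algebra_simps)
  ultimately show "\<exists>B\<in>carrier SL2Z. B \<otimes>\<^bsub>SL2Z\<^esub> A = \<one>\<^bsub>SL2Z\<^esub>"
    by (auto simp: SL2Z_def)
qed (auto simp: SL2Z_def det_mul matrix_mul_assoc)

lemma normal_SL2Z_center: "SL2Z_center \<lhd> SL2Z"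
proof -
  interpret group SL2Z by (rule group_SL2Z)
  have det_neg: "det (- mat 1 :: int^2^2) = 1"
    by (simp add: det_2 mat_def)
  have neg: "(- mat 1) ** A = - A" "A ** (- mat 1) = - A" for A :: "int^2^2"
    by (simp_all add: vec_eq_iff forall_2 matrix_matrix_mult_def sum_2 mat_def)
  have inv_neg: "inv\<^bsub>SL2Z\<^esub> (- mat 1) = - mat 1"
    by (rule inv_equality) (auto simp: SL2Z_def det_neg neg)
  have inv_one': "inv\<^bsub>SL2Z\<^esub> (mat 1) = mat 1"
    using inv_one by (simp add: SL2Z_def)
  have "subgroup SL2Z_center SL2Z"
  proof
    show "inv\<^bsub>SL2Z\<^esub> x \<in> SL2Z_center" if "x \<in> SL2Z_center" for x
      using that by (auto simp: SL2Z_center_def inv_neg inv_one')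
  qed (auto simp: SL2Z_center_def SL2Z_def det_neg neg)
  then show ?thesis
    by (rule normalI) (auto simp: r_coset_def l_coset_def SL2Z_center_def SL2Z_def neg)
qed

lemma group_PSL2Z: "group PSL2Z"
  unfolding PSL2Z_def by (rule normal.factorgroup_is_group[OF normal_SL2Z_center])


section \<open>Hyperbolic elements and their axes\<close>

definition hyperbolic :: "(int^2^2) set \<Rightarrow> bool" where
  "hyperbolic g \<longleftrightarrow> g \<in> carrier PSL2Z \<and> (\<exists>A\<in>g. \<bar>trace A\<bar> > 2)"

text \<open>Fixed points of the Moebius transformation; the side condition is needed since
  division by zero yields zero. The fixed points of a hyperbolic element are irrational
  (the square of its trace minus 4 is not a square), so infinity need not be considered.\<close>

definition real_fixed_point :: "int^2^2 \<Rightarrow> real \<Rightarrow> bool" where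
  "real_fixed_point A x \<longleftrightarrow>
     of_int (A$2$1) * x + of_int (A$2$2) \<noteq> 0 \<and>
     (of_int (A$1$1) * x + of_int (A$1$2)) / (of_int (A$2$1) * x + of_int (A$2$2)) = x"

text \<open>The geodesic of the upper half plane with the distinct real endpoints \<open>x\<close> and \<open>y\<close>:
  the half circle orthogonal to the real line.\<close>

definition hyp_geodesic :: "real \<Rightarrow> real \<Rightarrow> complex set" where
  "hyp_geodesic x y = {z. Im z > 0 \<and> dist z (of_real ((x + y) / 2)) = \<bar>x - y\<bar> / 2}"

definition axis_of :: "(int^2^2) set \<Rightarrow> complex set" where
  "axis_of g = {z. \<exists>A\<in>g. \<exists>x y. x \<noteq> y \<and> real_fixed_point A x \<and> real_fixed_point A y \<and>
                     z \<in> hyp_geodesic x y}"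

definition rho :: complex where
  "rho = exp (of_real pi * \<i> / 3)"

definition R_rho :: "(int^2^2) set set set" where
  "R_rho = {conj_class PSL2Z g | g. hyperbolic g \<and> (\<exists>h\<in>conj_class PSL2Z g. rho \<in> axis_of h)}"

definition R_prim :: "(int^2^2) set set set" where
  "R_prim = {c \<in> R_rho. \<exists>g. primitive_elt PSL2Z g \<and> c = conj_class PSL2Z g}"


section \<open>The parametrization\<close>

definition Delta :: "int \<times> int \<Rightarrow> int" where
  "Delta = (\<lambda>(B, C). B^2 + C^2 - B * C)"

definition pairs_rho :: "(int \<times> int) set" where
  "pairs_rho = {(B, C). B > 0 \<and> C > 0 \<and> coprime B C \<and> \<not> is_square (Delta (B, C))}"

definition D_rho :: "int set" where
  "D_rho = Delta ` pairs_rho"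

definition pairs_at :: "int \<Rightarrow> (int \<times> int) set" where
  "pairs_at D = {p \<in> pairs_rho. Delta p = D}"

definition pell_sol :: "int \<Rightarrow> int \<times> int \<Rightarrow> bool" where
  "pell_sol D = (\<lambda>(T, k). T > 0 \<and> k > 0 \<and> T^2 - 4 * k^2 * D = 4)"

definition min_pell_sol :: "int \<Rightarrow> int \<times> int \<Rightarrow> bool" where
  "min_pell_sol D s \<longleftrightarrow>
     pell_sol D s \<and> (\<forall>s'. pell_sol D s' \<longrightarrow> fst s \<le> fst s' \<and> snd s \<le> snd s')"

definition the_min_sol :: "int \<Rightarrow> int \<times> int" where
  "the_min_sol D = (THE s. min_pell_sol D s)"

text \<open>Here \<open>T div 2\<close> is the exact quotient, as \<open>T\<close> is even for every solution.\<close>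

definition phi_mat :: "int \<times> int \<Rightarrow> int^2^2" where
  "phi_mat = (\<lambda>(B, C). let (T, k) = the_min_sol (Delta (B, C)) in
     mat2 (T div 2 - k * (B - C)) (k * B)
          (k * C) (T div 2 + k * (B - C)))"

definition phi :: "int \<times> int \<Rightarrow> (int^2^2) set set" where
  "phi p = conj_class PSL2Z (to_PSL2Z (phi_mat p))"

definition R_prim_at :: "int \<Rightarrow> (int^2^2) set set set" where
  "R_prim_at D = phi ` pairs_at D"

text \<open>Only used for \<open>e1, e2 \<in> {0, 1}\<close>.\<close>

definition D_rho_eps :: "nat \<Rightarrow> nat \<Rightarrow> int set" where
  "D_rho_eps e1 e2 = {D \<in> D_rho.
     (even (snd (the_min_sol D)) \<longleftrightarrow> e1 = 0) \<and>
     ((\<exists>t u :: int. t^2 - 4 * u^2 * D = 9 \<and> gcd 3 u = 1) \<longleftrightarrow> e2 = 0)}"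

definition n_to_one_onto :: "nat \<Rightarrow> ('a \<Rightarrow> 'b) \<Rightarrow> 'a set \<Rightarrow> 'b set \<Rightarrow> bool" where
  "n_to_one_onto n f A B \<longleftrightarrow> f ` A = B \<and> (\<forall>b\<in>B. card {a \<in> A. f a = b} = n)"

end

theory Submission
  imports Defs
begin

text \<open>
  An axis through \<open>\<rho>\<close> with its orientation is a primitive vector \<open>(B, C)\<close> of the hexagonal lattice
  with norm \<open>\<Delta>\<close>; the order 3 stabilizer of \<open>\<rho>\<close> rotates the lattice, and each orbit has exactly
  one vector in the open sector \<open>B, C > 0\<close>. The hyperbolic elements with this axis are
  \<open>s + k N\<close> with \<open>s\<^sup>2 - \<Delta> k\<^sup>2 = 1\<close>, hence powers of the fundamental one up to inversion, which
  gives surjectivity.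

  The fibre of \<open>(B, C)\<close> is in bijection with the points \<open>\<gamma>\<rho>\<close> on the axis modulo the fundamental
  element. Such a point is the fixed point of an order 3 element \<open>R\<close>, where \<open>2 R - 1\<close> has square \<open>-3\<close> and
  anticommutes with \<open>N\<close>; these matrices correspond to the numbers \<open>t + 2 u \<surd>\<Delta>\<close> of norm 9 with \<open>t > 0\<close>
  and \<open>t \<equiv> (B + C) u\<close> modulo 3, and each of those occurs because there is only one class of positive
  definite forms of discriminant \<open>-3\<close>. The fundamental element multiplies these
  numbers by the square of the fundamental unit. The numbers with \<open>3\<close> dividing \<open>u\<close>, and those
  with \<open>3\<close> not dividing \<open>u\<close> (if any), each form one orbit of the units of \<open>\<int>[2 \<surd>\<Delta>]\<close>, and the
  squares of the units of \<open>\<int>[\<surd>\<Delta>]\<close> have index 2 or 1 there as \<open>k\<close> is even or odd.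
\<close>

section \<open>Solvability of Pell's equation\<close>

lemma sqrt_nonsquare_irrational:
  fixes d :: int
  assumes "d > 0" "\<not> is_square d"
  shows "sqrt (of_int d) \<notin> \<rat>"
proof
  assume "sqrt (of_int d) \<in> \<rat>"
  then obtain a b :: int where ab: "b > 0" "sqrt (of_int d) = of_int a / of_int b"
    by (elim Rats_cases') auto
  then have "real_of_int d = (of_int a / of_int b)^2"
    using assms(1) by (metis real_sqrt_pow2 of_int_0_le_iff less_imp_le)
  then have "real_of_int (d * b^2) = of_int (a^2)"
    using ab(1) by (simp add: field_simps)
  then have eq: "d * b^2 = a^2"
    by (simp only: of_int_eq_iff)
  then have "b dvd a"
    by (metis dvd_triv_right pos2 pow_divides_pow_iff)
  then obtain c where "a = b * c" ..
  with eq ab(1) have "d = c^2"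
    by (simp add: power2_eq_square algebra_simps)
  with assms(2) show False by auto
qed

text \<open>With q = \<surd>d, an approximation h/k satisfies |q k - h| < 1/k and q k + h \<le> 2 q
  k + 1/k. The product of the two factors bounds h^2 - d k^2 independently of k.\<close>

lemma approx_set_bounds:
  fixes d h k :: int
  assumes "d > 0" "(h, k) \<in> approx_set (sqrt (of_int d))"
  shows "k > 0" "h > 0" "coprime h k" "\<bar>h^2 - d * k^2\<bar> \<le> \<lceil>1 + 2 * sqrt (of_int d)\<rceil>"
proof -
  define q where "q = sqrt (of_int d)"
  have q: "q \<ge> 1" "q^2 = of_int d"
    using assms(1) by (auto simp: q_def)
  show k: "k > 0" and "coprime h k"
    using assms by (auto simp: approx_set_def)
  define K where "K = real_of_int k"
  define H where "H = real_of_int h"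
  have K: "K \<ge> 1"
    using k by (simp add: K_def)
  have "\<bar>q - H / K\<bar> < 1 / K^2"
    using assms by (auto simp: approx_set_def q_def H_def K_def)
  then have "\<bar>q - H / K\<bar> * K < 1 / K^2 * K"
    using K by (intro mult_strict_right_mono) auto
  moreover have "\<bar>q - H / K\<bar> * K = \<bar>(q - H / K) * K\<bar>"
    using K by (simp add: abs_mult)
  ultimately have b: "\<bar>q * K - H\<bar> < 1 / K"
    using K by (simp add: field_simps power2_eq_square)
  have K1: "1 / K \<le> 1"
    using K by simp
  have qK: "q * K \<ge> 1 * 1"
    using q K by (intro mult_mono) auto
  with b K1 have "H > 0"
    by linarith
  then show "h > 0"
    by (simp add: H_def)
  have "\<bar>q * K + H\<bar> \<le> 1 / K + 2 * (q * K)"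
    using b qK \<open>H > 0\<close> by linarith
  then have "\<bar>q * K - H\<bar> * \<bar>q * K + H\<bar> \<le> 1 / K * (1 / K + 2 * (q * K))"
    using b K by (intro mult_mono) auto
  also have "\<dots> = 1 / K * (1 / K) + 2 * q"
    using K by (simp add: field_simps)
  also have "\<dots> \<le> 1 * 1 + 2 * q"
    using K K1 q(1) by (intro add_mono mult_mono) auto
  finally have "\<bar>(q * K - H) * (q * K + H)\<bar> \<le> 1 + 2 * q"
    by (simp add: abs_mult)
  moreover have "(q * K - H) * (q * K + H) = q^2 * K^2 - H^2"
    by (simp add: algebra_simps power2_eq_square)
  then have "(q * K - H) * (q * K + H) = - real_of_int (h^2 - d * k^2)"
    by (simp add: q H_def K_def)
  ultimately have "real_of_int \<bar>h^2 - d * k^2\<bar> \<le> 1 + 2 * q"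
    by simp
  then show "\<bar>h^2 - d * k^2\<bar> \<le> \<lceil>1 + 2 * sqrt (of_int d)\<rceil>"
    unfolding q_def by linarith
qed

text \<open>Dirichlet's argument: infinitely many approximations have bounded norm, so infinitely
  many share a norm n, and among these infinitely many agree modulo n. The quotient of two such is
  an integral unit.\<close>

lemma pell_exists:
  fixes d :: int
  assumes "d > 0" "\<not> is_square d"
  obtains x y :: int where "x > 0" "y > 0" "x^2 - d * y^2 = 1"
proof -
  define f where "f = (\<lambda>(h, k). h^2 - d * k^2)"
  define A where "A = approx_set (sqrt (of_int d))"
  note A = approx_set_bounds[OF assms(1), folded A_def]
  have "infinite A"
    using sqrt_nonsquare_irrational[OF assms] rational_iff_finite_approx_set by (simp add: A_def)
  moreover have "finite (f ` A)"
  proof (rule finite_subset)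
    show "f ` A \<subseteq> {- \<lceil>1 + 2 * sqrt (of_int d)\<rceil> .. \<lceil>1 + 2 * sqrt (of_int d)\<rceil>}"
      using A(4) by (force simp: f_def abs_le_iff)
  qed simp
  ultimately have "\<exists>p\<in>A. infinite {a \<in> A. f a = f p}"
    by (rule pigeonhole_infinite)
  then obtain p where p: "infinite {a \<in> A. f a = f p}" ..
  define n where "n = f p"
  define A1 where "A1 = {a \<in> A. f a = n}"
  have inf1: "infinite A1"
    using p by (simp add: A1_def n_def)
  \<comment> \<open>Norm zero with h and k coprime forces k^2 = 1, and then d is the square of
    h.\<close>
  have n0: "n \<noteq> 0"
  proof
    assume "n = 0"
    moreover obtain h k where "(h, k) \<in> A1"
      using infinite_imp_nonempty[OF inf1] by auto
    ultimately have "h^2 = d * k^2" "coprime h k"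
      using A by (auto simp: A1_def f_def)
    then have "k^2 dvd h^2"
      using dvd_triv_right[of "k^2" d] by metis
    moreover have "coprime (h^2) (k^2)"
      using \<open>coprime h k\<close> by simp
    ultimately have "is_unit (k^2)"
      by (meson coprime_common_divisor dvd_refl)
    then have "k^2 = 1"
      by (simp add: zdvd1_eq)
    then show False
      using \<open>h^2 = d * k^2\<close> assms(2) by (metis is_nth_powerI mult.right_neutral)
  qed
  define g where "g = (\<lambda>(h, k). (h mod n, k mod n))"
  have "finite (g ` A1)"
  proof (rule finite_subset)
    have "x mod n \<in> {-\<bar>n\<bar>..\<bar>n\<bar>}" for x
      using n0 abs_mod_less[of n x] by auto
    then show "g ` A1 \<subseteq> {-\<bar>n\<bar>..\<bar>n\<bar>} \<times> {-\<bar>n\<bar>..\<bar>n\<bar>}"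
      by (auto simp: g_def)
  qed simp
  from pigeonhole_infinite[OF inf1 this] obtain q where q: "infinite {a \<in> A1. g a = g q}"
    by blast
  obtain a where a: "a \<in> {a \<in> A1. g a = g q}"
    using infinite_imp_nonempty[OF q] by blast
  obtain b where b: "b \<in> {a \<in> A1. g a = g q}" "b \<noteq> a"
    using infinite_imp_nonempty[OF infinite_remove[OF q, of a]] by blast
  obtain h1 k1 h2 k2 where ab: "a = (h1, k1)" "b = (h2, k2)"
    by (metis surj_pair)
  have mem: "(h1, k1) \<in> A" "(h2, k2) \<in> A"
    and norm: "h1^2 - d * k1^2 = n" "h2^2 - d * k2^2 = n"
    and m: "h1 mod n = h2 mod n" "k1 mod n = k2 mod n"
    using a b by (cases q; auto simp: ab A1_def f_def g_def)+
  have "n dvd h1 - h2" "n dvd k1 - k2"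
    using m by (simp_all add: mod_eq_dvd_iff)
  then obtain r s where rs: "h1 = h2 + n * r" "k1 = k2 + n * s"
    by (metis dvd_def diff_eq_eq add.commute)
  \<comment> \<open>Up to the sign of y, these are the coordinates of (h1 + k1 \<surd>d) / (h2 + k2
    \<surd>d); the congruences in \<open>rs\<close> carry out the division by n.\<close>
  define x where "x = 1 + h2 * r - d * k2 * s"
  define y where "y = k2 * r - h2 * s"
  have x: "n * x = h1 * h2 - d * k1 * k2"
    using norm(2) by (simp add: x_def rs power2_eq_square algebra_simps)
  have y: "n * y = h1 * k2 - h2 * k1"
    unfolding y_def rs by algebra
  have "(n * x)^2 - d * (n * y)^2 = (h1^2 - d * k1^2) * (h2^2 - d * k2^2)"
    unfolding x y by algebra
  also have "\<dots> = n * n"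
    by (simp add: norm)
  finally have "(n * x)^2 - d * (n * y)^2 = n * n" .
  then have "n^2 * (x^2 - d * y^2) = n^2 * 1"
    by (simp add: power2_eq_square algebra_simps)
  then have xy: "x^2 - d * y^2 = 1"
    using n0 by simp
  \<comment> \<open>Otherwise h1/k1 = h2/k2, and two positive fractions in lowest terms would
    coincide.\<close>
  have "y \<noteq> 0"
  proof
    assume "y = 0"
    then have eq: "h1 * k2 = h2 * k1"
      using y by simp
    have "h1 = h2"
    proof -
      have "h1 dvd h2" "h2 dvd h1"
        using eq A(3)[OF mem(1)] A(3)[OF mem(2)]
        by (metis coprime_dvd_mult_left_iff dvd_triv_left)+
      then show ?thesis
        using A(2)[OF mem(1)] A(2)[OF mem(2)] by (simp add: zdvd_antisym_nonneg)
    qed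
    moreover from this eq A(2)[OF mem(1)] have "k1 = k2"
      by simp
    ultimately show False
      using b(2) ab by simp
  qed
  moreover have "x \<noteq> 0"
  proof
    assume "x = 0"
    then have "d * y^2 = -1" using xy by simp
    then show False using assms(1) by (smt (verit) mult_nonneg_nonneg zero_le_power2)
  qed
  ultimately show thesis
    using xy by (intro that[of "\<bar>x\<bar>" "\<bar>y\<bar>"]) auto
qed

section \<open>Units of norm 1\<close>

text \<open>\<open>s + k \<surd>D\<close> is the fundamental unit. Minimality concerns the second
  coordinate alone, which fixes the first up to sign.\<close>

locale min_pell =
  fixes D s k :: int
  assumes D_pos: "D > 0" and s_pos: "s > 0" and k_pos: "k > 0"
    and unit: "s^2 - D * k^2 = 1"
    and minimal: "\<And>a b. b > 0 \<Longrightarrow> a^2 - D * b^2 = 1 \<Longrightarrow> k \<le> b"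
begin

lemma unit_mult:
  assumes "a^2 - D * b^2 = 1" "x^2 - D * y^2 = 1"
  shows "(a * x + D * (b * y))^2 - D * (a * y + b * x)^2 = 1"
proof -
  have "(a * x + D * (b * y))^2 - D * (a * y + b * x)^2 = (a^2 - D * b^2) * (x^2 - D * y^2)"
    by algebra
  with assms show ?thesis by simp
qed

text \<open>Induction form of the fact that units with nonnegative coordinates are powers of the
  fundamental one: dividing by it keeps the signs and strictly lowers b.\<close>

lemma unit_induct [consumes 3, case_names one step]:
  assumes "a^2 - D * b^2 = 1" "a > 0" "b \<ge> 0"
    and one: "P 1 0"
    and step: "\<And>a b. a^2 - D * b^2 = 1 \<Longrightarrow> a > 0 \<Longrightarrow> b \<ge> 0 \<Longrightarrow> P a b \<Longrightarrow>
      P (a * s + D * (b * k)) (a * k + b * s)"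
  shows "P a b"
  using assms(1-3)
proof (induction "nat b" arbitrary: a b rule: less_induct)
  case less
  show ?case
  proof (cases "b = 0")
    case True
    with less.prems have "a = 1"
      by (simp add: power2_eq_1_iff)
    with True one show ?thesis by simp
  next
    case False
    then have b: "b > 0" "k \<le> b"
      using less.prems minimal by auto
    \<comment> \<open>The quotient by the fundamental unit, that is, the product with
      \<open>s - k \<surd>D\<close>.\<close>
    define a' where "a' = a * s - D * (b * k)"
    define b' where "b' = b * s - a * k"
    have unit': "a'^2 - D * b'^2 = 1"
      using unit_mult[OF less.prems(1), of s "-k"] unit by (simp add: a'_def b'_def algebra_simps)
    have "(a * s)^2 = (1 + D * b^2) * (1 + D * k^2)"
      using less.prems(1) unit by (simp add: power_mult_distrib algebra_simps)
    also have "\<dots> = 1 + D * b^2 + D * k^2 + (D * (b * k))^2"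
      by algebra
    also have "\<dots> > (D * (b * k))^2"
    proof -
      have "D * b^2 \<ge> 0" "D * k^2 \<ge> 0"
        using D_pos by simp_all
      then show ?thesis by linarith
    qed
    finally have "a' > 0"
      using power_less_imp_less_base[of "D * (b * k)" 2 "a * s"] less.prems s_pos by (simp add: a'_def)
    have "(b * s)^2 - (a * k)^2 = b^2 * (1 + D * k^2) - k^2 * (1 + D * b^2)"
      using less.prems(1) unit by (simp add: power_mult_distrib algebra_simps)
    also have "\<dots> = b^2 - k^2"
      by (simp add: algebra_simps)
    also have "\<dots> \<ge> 0"
      using b k_pos by simp
    finally have "b' \<ge> 0"
      using power2_le_imp_le[of "a * k" "b * s"] b s_pos by (simp add: b'_def)
    \<comment> \<open>The resulting bound (b (s - 1))^2 < (a k)^2 is the descent b' < b after taking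
      roots.\<close>
    have "(a * k)^2 = k^2 * (1 + D * b^2)"
      using less.prems(1) by (simp add: power_mult_distrib algebra_simps)
    also have "\<dots> = k^2 + b^2 * (s^2 - 1)"
      using unit by algebra
    also have "\<dots> = (b * (s - 1))^2 + k^2 + 2 * b^2 * (s - 1)"
      by algebra
    also have "\<dots> > (b * (s - 1))^2"
    proof -
      have "2 * b^2 * (s - 1) \<ge> 0" "k^2 > 0"
        using s_pos k_pos by auto
      then show ?thesis by linarith
    qed
    finally have "b * (s - 1) < a * k"
      using power_less_imp_less_base[of "b * (s - 1)" 2 "a * k"] less.prems k_pos by simp
    then have "b' < b"
      by (simp add: b'_def algebra_simps)
    then have "P a' b'"
      using less.hyps[of b' a'] unit' \<open>a' > 0\<close> \<open>b' \<ge> 0\<close> by simp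
    from step[OF unit' \<open>a' > 0\<close> \<open>b' \<ge> 0\<close> this]
    have "P (a' * s + D * (b' * k)) (a' * k + b' * s)" .
    moreover have "a' * s + D * (b' * k) = a * (s^2 - D * k^2)"
      unfolding a'_def b'_def by algebra
    moreover have "a' * k + b' * s = b * (s^2 - D * k^2)"
      unfolding a'_def b'_def by algebra
    ultimately show ?thesis
      using unit by simp
  qed
qed

text \<open>Parity of the exponent: a power of the fundamental unit is a square or the fundamental
  unit times a square. The terms x^2 + D y^2 and 2 x y are the coordinates of the square of x + y
  \<surd>D.\<close>

lemma unit_cases_nonneg:
  assumes "a^2 - D * b^2 = 1" "a > 0" "b \<ge> 0"
  shows "\<exists>x y. x^2 - D * y^2 = 1 \<and>
    (a = x^2 + D * y^2 \<and> b = 2 * x * y \<or>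
     a = s * (x^2 + D * y^2) + D * k * (2 * x * y) \<and> b = s * (2 * x * y) + k * (x^2 + D * y^2))"
  using assms
proof (induction a b rule: unit_induct)
  case one
  show ?case
    by (rule exI[of _ 1], rule exI[of _ 0]) simp
next
  case (step a b)
  then obtain x y where xy: "x^2 - D * y^2 = 1"
    and ab: "a = x^2 + D * y^2 \<and> b = 2 * x * y \<or>
     a = s * (x^2 + D * y^2) + D * k * (2 * x * y) \<and> b = s * (2 * x * y) + k * (x^2 + D * y^2)"
    by blast
  from ab show ?case
  proof (elim disjE)
    assume "a = x^2 + D * y^2 \<and> b = 2 * x * y"
    with xy show ?thesis
      by (intro exI[of _ x] exI[of _ y]) (simp add: algebra_simps)
  next
    assume *: "a = s * (x^2 + D * y^2) + D * k * (2 * x * y) \<and> b = s * (2 * x * y) + k * (x^2 + D * y^2)"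
    let ?x = "s * x + D * (k * y)" and ?y = "s * y + k * x"
    have "?x^2 - D * ?y^2 = 1"
      using unit xy by (rule unit_mult)
    moreover have "a * s + D * (b * k) = ?x^2 + D * ?y^2" "a * k + b * s = 2 * ?x * ?y"
      using * by algebra+
    ultimately show ?thesis by blast
  qed
qed

lemma unit_cases:
  assumes "a^2 - D * b^2 = 1" "a > 0"
  shows "\<exists>x y. x^2 - D * y^2 = 1 \<and>
    (a = x^2 + D * y^2 \<and> b = 2 * x * y \<or>
     a = s * (x^2 + D * y^2) + D * k * (2 * x * y) \<and> b = s * (2 * x * y) + k * (x^2 + D * y^2))"
proof (cases "b \<ge> 0")
  case True
  with assms show ?thesis by (rule unit_cases_nonneg)
next
  case False
  with assms unit_cases_nonneg[of a "-b"] obtain x y where xy: "x^2 - D * y^2 = 1"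
    and ab: "a = x^2 + D * y^2 \<and> -b = 2 * x * y \<or>
     a = s * (x^2 + D * y^2) + D * k * (2 * x * y) \<and> -b = s * (2 * x * y) + k * (x^2 + D * y^2)"
    by auto
  from ab show ?thesis
  proof (elim disjE)
    assume "a = x^2 + D * y^2 \<and> -b = 2 * x * y"
    with xy show ?thesis
      by (intro exI[of _ x] exI[of _ "-y"]) simp
  next
    assume *: "a = s * (x^2 + D * y^2) + D * k * (2 * x * y) \<and> -b = s * (2 * x * y) + k * (x^2 + D * y^2)"
    \<comment> \<open>Conjugating \<epsilon> \<xi>^2, with \<epsilon> fundamental, gives \<epsilon>
      times the square of the conjugate of \<epsilon> \<xi>.\<close>
    let ?x = "s * x + D * (k * y)" and ?y = "s * y + k * x"
    have "?x^2 - D * (-?y)^2 = 1"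
      using unit_mult[OF unit xy] by (simp only: power2_minus)
    moreover have "a = s * (?x^2 + D * (-?y)^2) + D * k * (2 * ?x * (-?y))"
      using * unit by algebra
    moreover have "b = s * (2 * ?x * (-?y)) + k * (?x^2 + D * (-?y)^2)"
      using * unit by algebra
    ultimately show ?thesis by blast
  qed
qed

text \<open>For odd k, the fundamental unit times a square has odd second coordinate, so only
  squares remain. This is the index 1 case.\<close>

lemma even_unit_square:
  assumes "odd k" "a^2 - D * (2 * b)^2 = 1" "a > 0"
  shows "\<exists>x y. x^2 - D * y^2 = 1 \<and> a = x^2 + D * y^2 \<and> b = x * y"
proof -
  obtain x y where xy: "x^2 - D * y^2 = 1"
    and ab: "a = x^2 + D * y^2 \<and> 2 * b = 2 * x * y \<or>
     a = s * (x^2 + D * y^2) + D * k * (2 * x * y) \<and> 2 * b = s * (2 * x * y) + k * (x^2 + D * y^2)"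
    using unit_cases[OF assms(2,3)] by blast
  have "x^2 + D * y^2 = 1 + 2 * (D * y^2)"
    using xy by simp
  then have "odd (x^2 + D * y^2)"
    by simp
  then have "odd (s * (2 * x * y) + k * (x^2 + D * y^2))"
    using assms(1) by simp
  then have "2 * b \<noteq> s * (2 * x * y) + k * (x^2 + D * y^2)"
    by (metis dvd_triv_left)
  with ab xy show ?thesis by auto
qed

text \<open>For even k the fundamental unit itself lies in \<int>[2 \<surd>D], so both classes
  modulo squares survive. This is the index 2 case.\<close>

lemma even_unit_cases:
  assumes "k = 2 * l" "a^2 - D * (2 * b)^2 = 1" "a > 0"
  shows "\<exists>x y. x^2 - D * y^2 = 1 \<and>
    (a = x^2 + D * y^2 \<and> b = x * y \<or>
     a = s * (x^2 + D * y^2) + 4 * D * l * (x * y) \<and> b = s * (x * y) + l * (x^2 + D * y^2))"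
proof -
  obtain x y where xy: "x^2 - D * y^2 = 1"
    and ab: "a = x^2 + D * y^2 \<and> 2 * b = 2 * x * y \<or>
     a = s * (x^2 + D * y^2) + D * k * (2 * x * y) \<and> 2 * b = s * (2 * x * y) + k * (x^2 + D * y^2)"
    using unit_cases[OF assms(2,3)] by blast
  show ?thesis
    using ab xy assms(1) by (intro exI[of _ x] exI[of _ y]) (auto simp: algebra_simps)
qed

text \<open>A square root x + y \<surd>D of the fundamental unit would have 0 < |y| < k, against
  minimality.\<close>

lemma fundamental_not_square:
  assumes "x^2 - D * y^2 = 1"
  shows "k \<noteq> 2 * (x * y)"
proof
  assume k: "k = 2 * (x * y)"
  then have nz: "x \<noteq> 0" "y \<noteq> 0"
    using k_pos by auto
  have "k \<le> \<bar>y\<bar>"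
    using minimal[of "\<bar>y\<bar>" x] assms nz by simp
  moreover have "k = 2 * \<bar>x\<bar> * \<bar>y\<bar>"
    using k k_pos by (simp add: abs_mult[symmetric])
  moreover have "\<bar>x\<bar> \<ge> 1" "\<bar>y\<bar> > 0"
    using nz by auto
  moreover have "\<bar>x\<bar> * \<bar>y\<bar> \<ge> 1 * \<bar>y\<bar>"
    using nz by (intro mult_right_mono) auto
  ultimately show False by linarith
qed

end

section \<open>Integral matrices and rotations of order three\<close>

lemma mat2_eq_iff: "mat2 a b c d = mat2 a' b' c' d' \<longleftrightarrow> a = a' \<and> b = b' \<and> c = c' \<and> d = d'"
  by (auto simp: vec_eq_iff forall_2)

lemma mat2_exhaust: obtains a b c d where "A = mat2 a b c d"
proof
  show "A = mat2 (A$1$1) (A$1$2) (A$2$1) (A$2$2)"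
    by (simp add: vec_eq_iff forall_2)
qed

lemma mat2_mult: "mat2 a b c d ** mat2 a' b' c' d' =
    mat2 (a * a' + b * c') (a * b' + b * d') (c * a' + d * c') (c * b' + d * d')"
  by (simp add: vec_eq_iff forall_2 matrix_matrix_mult_def sum_2)

lemma det_mat2: "det (mat2 a b c d) = a * d - b * c"
  by (simp add: det_2)

lemma trace_mat2: "trace (mat2 a b c d) = a + d"
  by (simp add: trace_def sum_2)

lemma uminus_mat2: "- mat2 a b c d = mat2 (- a) (- b) (- c) (- d)"
  by (simp add: vec_eq_iff forall_2)

lemma mat_1_mat2: "mat 1 = mat2 1 0 0 1"
  by (simp add: vec_eq_iff forall_2 mat_def)

text \<open>The adjugate, which serves as the inverse for determinant 1.\<close>

definition adj2 :: "int^2^2 \<Rightarrow> int^2^2" where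
  "adj2 A = mat2 (A$2$2) (- A$1$2) (- A$2$1) (A$1$1)"

lemma adj2_mat2: "adj2 (mat2 a b c d) = mat2 d (- b) (- c) a"
  by (simp add: adj2_def)

lemma
  assumes "det A = 1"
  shows adj2_mult: "adj2 A ** A = mat 1" and mult_adj2: "A ** adj2 A = mat 1"
    and det_adj2: "det (adj2 A) = 1"
  using assms
  by (cases A rule: mat2_exhaust; simp add: adj2_mat2 mat2_mult mat_1_mat2 det_mat2 mat2_eq_iff algebra_simps)+

text \<open>Conjugacy of X and Y is always expressed as g X = Y g, which stays within products of
  integer matrices; such relations compose.\<close>

lemma intertwine_trans:
  fixes g h X Y Z :: "int^2^2"
  assumes "g ** X = Y ** g" "h ** Y = Z ** h"
  shows "(h ** g) ** X = Z ** (h ** g)"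
  by (metis assms matrix_mul_assoc)

lemma intertwine_adj2:
  fixes g X Y :: "int^2^2"
  assumes "det g = 1" "g ** X = Y ** g"
  shows "adj2 g ** Y = X ** adj2 g"
proof -
  have "adj2 g ** Y = adj2 g ** (Y ** (g ** adj2 g))"
    using assms(1) by (simp add: mult_adj2)
  also have "\<dots> = adj2 g ** g ** X ** adj2 g"
    using assms(2) by (metis matrix_mul_assoc)
  finally show ?thesis
    using assms(1) by (simp add: adj2_mult)
qed

lemma intertwine_unique:
  fixes g X Y Y' :: "int^2^2"
  assumes "det g = 1" "g ** X = Y ** g" "g ** X = Y' ** g"
  shows "Y = Y'"
proof -
  have "(Y ** g) ** adj2 g = (Y' ** g) ** adj2 g"
    using assms(2,3) by metis
  then show ?thesis
    using assms(1) by (simp add: mult_adj2 flip: matrix_mul_assoc)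
qed

text \<open>
  \<open>axis_mat B C s k\<close> is \<open>s + k N\<close> with \<open>N\<^sup>2 = \<Delta>\<close>, where the axis of \<open>N\<close> passes through \<open>\<rho>\<close>.
  \<open>rho_mat\<close> is \<open>2 R - 1\<close> for the element \<open>R\<close> of order 3 in \<open>PSL\<^sub>2(\<int>)\<close> that fixes \<open>\<rho>\<close>, so its square
  is \<open>-3\<close>. A conjugate of \<open>rho_mat\<close> anticommutes with \<open>N\<close> iff its fixed point lies on the axis
  of \<open>N\<close>, and then it has the form \<open>ell_mat B C b u\<close>.
\<close>

definition axis_mat :: "int \<Rightarrow> int \<Rightarrow> int \<Rightarrow> int \<Rightarrow> int^2^2" where
  "axis_mat B C s k = mat2 (s - k * (B - C)) (k * B) (k * C) (s + k * (B - C))"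

definition ell_mat :: "int \<Rightarrow> int \<Rightarrow> int \<Rightarrow> int \<Rightarrow> int^2^2" where
  "ell_mat B C b u = mat2 b (- 2 * (b - B * u)) (2 * (b - C * u)) (- b)"

definition rho_mat :: "int^2^2" where
  "rho_mat = mat2 1 (- 2) 2 (- 1)"

lemma Delta_pair: "Delta (B, C) = B^2 + C^2 - B * C"
  by (simp add: Delta_def)

lemma det_axis_mat: "det (axis_mat B C s k) = s^2 - Delta (B, C) * k^2"
  unfolding axis_mat_def det_mat2 Delta_pair by algebra

lemma trace_axis_mat: "trace (axis_mat B C s k) = 2 * s"
  by (simp add: axis_mat_def trace_mat2)

lemma axis_mat_mult:
  "axis_mat B C a b ** axis_mat B C s k =
     axis_mat B C (a * s + Delta (B, C) * (b * k)) (a * k + b * s)"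
  unfolding axis_mat_def mat2_mult mat2_eq_iff Delta_pair by (intro conjI; algebra)

lemma coprime_proportional:
  fixes B C b c :: int
  assumes "coprime B C" "B \<noteq> 0" "b * C = B * c"
  obtains k where "b = k * B" "c = k * C"
proof -
  have "B dvd b * C" using assms by simp
  then have "B dvd b" using assms(1) by (simp add: coprime_dvd_mult_left_iff)
  then obtain k where "b = B * k" ..
  with assms show thesis by (intro that[of k]) (auto simp: algebra_simps)
qed

text \<open>Commuting with N forces the off-diagonal entries to be proportional to (B, C);
  coprimality makes the factor k an integer, and the diagonal then follows.\<close>

lemma centralizer_axis_mat:
  assumes "coprime B C" "B \<noteq> 0" "g ** axis_mat B C 0 1 = axis_mat B C 0 1 ** g"
  obtains s k where "g = axis_mat B C s k"
proof -
  obtain a b c d where g: "g = mat2 a b c d" by (rule mat2_exhaust[of g])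
  have eqs: "b * C = B * c" "B * (d - a) = 2 * b * (B - C)"
    using assms(3) unfolding g axis_mat_def mat2_mult mat2_eq_iff by (elim conjE; algebra)+
  obtain k where k: "b = k * B" "c = k * C"
    using coprime_proportional[OF assms(1,2) eqs(1)] .
  have "B * (d - a) = B * (2 * k * (B - C))"
    using eqs(2) k by (simp add: algebra_simps)
  then have "d - a = 2 * k * (B - C)"
    using assms(2) by simp
  then show thesis
    by (intro that[of "a + k * (B - C)" k]) (simp add: g axis_mat_def mat2_eq_iff k algebra_simps)
qed

text \<open>The commutant is a copy of the Eisenstein integers, with determinant a^2 + a b +
  b^2.\<close>

lemma centralizer_rho_mat:
  assumes "g ** rho_mat = rho_mat ** g"
  obtains a b where "g = mat2 a b (- b) (a + b)"
proof -
  obtain a b c d where g: "g = mat2 a b c d" by (rule mat2_exhaust[of g])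
  have "c = - b" "d = a + b"
    using assms unfolding g rho_mat_def mat2_mult mat2_eq_iff by linarith+
  with g show thesis by (intro that[of a b]) simp
qed

text \<open>Used to recognize that a conjugate of N is again the N of some pair (B, C).\<close>

lemma anticommute_rho_mat:
  assumes "X ** rho_mat = - (rho_mat ** X)"
  obtains B C where "X = axis_mat B C 0 1"
proof -
  obtain a b c d where X: "X = mat2 a b c d" by (rule mat2_exhaust[of X])
  have "a = c - b" "d = - a"
    using assms unfolding X rho_mat_def mat2_mult uminus_mat2 mat2_eq_iff by linarith+
  with X show thesis by (intro that[of b c]) (simp add: axis_mat_def)
qed

section \<open>The rotations about \<rho> acting on the vectors (B, C)\<close>

lemma rotation_unit_cases:
  fixes a b :: int
  assumes "a^2 + a * b + b^2 = 1"
  shows "(a, b) \<in> {(1, 0), (-1, 0), (0, 1), (0, -1), (1, -1), (-1, 1)}"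
proof -
  have "(2 * a + b)^2 + 3 * b^2 = 4" "(2 * b + a)^2 + 3 * a^2 = 4"
    using assms by algebra+
  then have "3 * b^2 \<le> 4" "3 * a^2 \<le> 4"
    by (smt (verit) zero_le_power2)+
  then have "a^2 \<le> 1^2" "b^2 \<le> 1^2"
    by simp_all
  then have "a \<in> {-1, 0, 1}" "b \<in> {-1, 0, 1}"
    unfolding abs_le_square_iff[symmetric] by auto
  with assms show ?thesis by auto
qed

text \<open>Up to sign, the six Eisenstein units give three rotations, and the two nontrivial ones
  move the open sector B, C > 0 off itself.\<close>

lemma rotation_unique:
  assumes "B > 0" "C > 0" "B' > 0" "C' > 0" "det g = 1"
    and "g ** rho_mat = rho_mat ** g" "g ** axis_mat B C 0 1 = axis_mat B' C' 0 1 ** g"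
  shows "B = B'" "C = C'"
proof -
  obtain a b where g: "g = mat2 a b (- b) (a + b)"
    using assms(6) by (rule centralizer_rho_mat)
  have "a^2 + a * b + b^2 = 1"
    using assms(5) unfolding g det_mat2 by algebra
  note ab = rotation_unit_cases[OF this]
  show "B = B'" "C = C'"
    using assms(1-4,7) ab unfolding g axis_mat_def mat2_mult mat2_eq_iff by auto
qed

text \<open>The rotations permute three open sectors that cover all vectors of nonsquare
  norm.\<close>

lemma rotation_exists:
  assumes "coprime B C" "\<not> is_square (Delta (B, C))"
  obtains B' C' g where "B' > 0" "C' > 0" "coprime B' C'" "Delta (B', C') = Delta (B, C)"
    "det g = 1" "g ** rho_mat = rho_mat ** g" "g ** axis_mat B C 0 1 = axis_mat B' C' 0 1 ** g"
proof -
  \<comment> \<open>On the lines B = 0, C = 0 and B = C, which contain the boundaries of the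
    sectors, the norm is a square.\<close>
  have nz: "B \<noteq> 0" "C \<noteq> 0" "B \<noteq> C"
    using assms(2) by (auto simp: Delta_pair power2_eq_square intro: is_nth_powerI)
  consider "B > 0" "C > 0" | "B < 0" "B < C" | "C < 0" "C < B"
    using nz by linarith
  then show thesis
  proof cases
    case 1
    with assms show thesis
      by (intro that[of B C "mat 1"]) (auto simp: det_I)
  next
    case 2
    have "coprime (C - B) (- B)"
      using assms(1) by (metis coprime_commute coprime_minus_right_iff coprime_diff_one_left gcd_diff1 coprime_iff_gcd_eq_1)
    moreover have "Delta (C - B, - B) = Delta (B, C)"
      unfolding Delta_pair by algebra
    ultimately show thesis
      using 2 by (intro that[of "C - B" "- B" "mat2 1 (-1) 1 0"])
        (auto simp: det_mat2 rho_mat_def axis_mat_def mat2_mult mat2_eq_iff)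
  next
    case 3
    have "coprime (- C) (B - C)"
      using assms(1) by (metis coprime_commute coprime_minus_right_iff gcd_diff1 coprime_iff_gcd_eq_1)
    moreover have "Delta (- C, B - C) = Delta (B, C)"
      unfolding Delta_pair by algebra
    ultimately show thesis
      using 3 by (intro that[of "- C" "B - C" "mat2 0 1 (-1) 1"])
        (auto simp: det_mat2 rho_mat_def axis_mat_def mat2_mult mat2_eq_iff)
  qed
qed

text \<open>
  This is class number 1 for discriminant \<open>-3\<close>: the matrix belongs to the form \<open>z X\<^sup>2 - b X Y + y Y\<^sup>2\<close>,
  which is reduced by descent on \<open>z\<close>.
\<close>

lemma elliptic_conj_rho_mat:
  fixes b y z :: int
  assumes "z > 0" "4 * y * z = b^2 + 3"
  shows "\<exists>g. det g = 1 \<and> g ** rho_mat = mat2 b (- 2 * y) (2 * z) (- b) ** g"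
  using assms
proof (induction "nat z" arbitrary: b y z rule: less_induct)
  case less
  \<comment> \<open>The translation that brings the middle coefficient into the interval from -z
    (excluded) to z.\<close>
  define n where "n = (z - b) div (2 * z)"
  define b' where "b' = b + 2 * n * z"
  define y' where "y' = y + n * b + n^2 * z"
  have "b' = z - (z - b) mod (2 * z)"
    using minus_mult_div_eq_mod[of "z - b" "2 * z"] by (simp add: b'_def n_def algebra_simps)
  moreover have "0 \<le> (z - b) mod (2 * z)" "(z - b) mod (2 * z) < 2 * z"
    using less.prems(1) by simp_all
  ultimately have b': "- z < b'" "b' \<le> z"
    by linarith+
  have eq': "4 * y' * z = b'^2 + 3"
    using less.prems(2) unfolding y'_def b'_def by algebra
  have shift: "mat2 1 (- n) 0 1 ** mat2 b' (- 2 * y') (2 * z) (- b') =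
      mat2 b (- 2 * y) (2 * z) (- b) ** mat2 1 (- n) 0 1"
    unfolding mat2_mult mat2_eq_iff b'_def y'_def by (intro conjI; algebra)
  have "\<exists>g. det g = 1 \<and> g ** rho_mat = mat2 b' (- 2 * y') (2 * z) (- b') ** g"
  proof (cases "z = 1")
    case True
    with b' have "b' = 0 \<or> b' = 1" by auto
    \<comment> \<open>The value b' = 0 would give 4 y' = 3.\<close>
    with eq' True have "b' = 1 \<and> y' = 1"
      by (elim disjE) (simp_all, presburger)
    with True show ?thesis
      by (intro exI[of _ "mat 1"]) (simp add: rho_mat_def)
  next
    case False
    \<comment> \<open>For z \<ge> 2 the reduced form has y' < z, and the inversion exchanges y' and
      z, so the induction hypothesis applies to the exchanged form.\<close>
    have "b'^2 \<le> z^2"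
      using b' by (intro power2_le_iff_abs_le[THEN iffD2]) auto
    moreover have "z^2 \<ge> 2 * z" "2 * z \<ge> 4"
      using False less.prems(1) by (auto simp: power2_eq_square)
    ultimately have "b'^2 + 3 < 4 * z^2"
      by linarith
    then have "4 * y' * z < 4 * z * z"
      using eq' by (simp add: power2_eq_square)
    then have "y' < z"
      using less.prems(1) by simp
    have "4 * y' * z > 0"
      using eq' by (smt (verit) zero_le_power2)
    then have "y' > 0"
      using less.prems(1) by (simp add: zero_less_mult_iff)
    obtain g where g: "det g = 1" "g ** rho_mat = mat2 (- b') (- 2 * z) (2 * y') b' ** g"
      using less.hyps[of y' z "- b'"] \<open>y' < z\<close> \<open>y' > 0\<close> eq' by (auto simp: mult_ac)
    have "mat2 0 (- 1) 1 0 ** mat2 (- b') (- 2 * z) (2 * y') b' =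
        mat2 b' (- 2 * y') (2 * z) (- b') ** mat2 0 (- 1) 1 0"
      by (simp add: mat2_mult mat2_eq_iff)
    from intertwine_trans[OF g(2) this] g(1) show ?thesis
      by (intro exI[of _ "mat2 0 (- 1) 1 0 ** g"]) (simp add: det_mul det_mat2)
  qed
  then obtain g where g: "det g = 1" "g ** rho_mat = mat2 b' (- 2 * y') (2 * z) (- b') ** g"
    by blast
  from intertwine_trans[OF g(2) shift] g(1) show ?case
    by (intro exI[of _ "mat2 1 (- n) 0 1 ** g"]) (simp add: det_mul det_mat2)
qed

section \<open>The points of the orbit of \<open>\<rho>\<close> on an axis\<close>

text \<open>The equation says that the traceless matrix \<open>ell_mat B C b u\<close> has
  determinant 3, hence square -3; the inequality selects one of the matrix and its negative.\<close>

definition on_axis :: "int \<Rightarrow> int \<Rightarrow> int \<times> int \<Rightarrow> bool" where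
  "on_axis B C = (\<lambda>(b, u). 3 * b^2 - 4 * (B + C) * b * u + 4 * B * C * u^2 = 3 \<and>
     3 * b - 2 * (B + C) * u > 0)"

text \<open>
  With \<open>t = 3 b - 2 (B + C) u\<close> the point \<open>(b, u)\<close> becomes the number \<open>t + 2 u \<surd>\<Delta>\<close> of
  norm 9; \<open>unit_act\<close> is its product with \<open>a + 2 c \<surd>\<Delta>\<close>.
\<close>

definition unit_act :: "int \<Rightarrow> int \<Rightarrow> int \<Rightarrow> int \<Rightarrow> int \<times> int \<Rightarrow> int \<times> int" where
  "unit_act B C a c = (\<lambda>(b, u). (b * a - 4 * B * C * u * c + 2 * (B + C) * b * c,
     u * a + (3 * b - 2 * (B + C) * u) * c))"

text \<open>Moving the point coded by (b, u) back to \<rho> turns the oriented axis of (B, C) into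
  that of (B', C').\<close>

definition linked :: "int \<times> int \<Rightarrow> int \<times> int \<Rightarrow> int \<times> int \<Rightarrow> bool" where
  "linked = (\<lambda>(B, C) (b, u) (B', C'). \<exists>g. det g = 1 \<and> g ** rho_mat = ell_mat B C b u ** g \<and>
     g ** axis_mat B' C' 0 1 = axis_mat B C 0 1 ** g)"

text \<open>The acting number is the square of the unit \<open>s + k \<surd>\<Delta>\<close>, which
  is how conjugation by \<open>axis_mat B C s k\<close> acts.\<close>

definition same_orbit :: "int \<Rightarrow> int \<Rightarrow> int \<times> int \<Rightarrow> int \<times> int \<Rightarrow> bool" where
  "same_orbit B C x x' \<longleftrightarrow> (\<exists>s k. s^2 - Delta (B, C) * k^2 = 1 \<and>
     x' = unit_act B C (s^2 + Delta (B, C) * k^2) (s * k) x)"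

text \<open>A matrix X anticommuting with N satisfies (s + k N) X (s - k N) = (s + k N)^2 X, so
  conjugation multiplies by the square of the unit.\<close>

lemma axis_mat_ell_mat:
  assumes "s^2 - Delta (B, C) * k^2 = 1"
    "(b', u') = unit_act B C (s^2 + Delta (B, C) * k^2) (s * k) (b, u)"
  shows "axis_mat B C s k ** ell_mat B C b u = ell_mat B C b' u' ** axis_mat B C s k"
proof -
  have b': "b' = b * (s^2 + Delta (B, C) * k^2) - 4 * B * C * u * (s * k) + 2 * (B + C) * b * (s * k)"
    and u': "u' = u * (s^2 + Delta (B, C) * k^2) + (3 * b - 2 * (B + C) * u) * (s * k)"
    using assms(2) by (simp_all add: unit_act_def)
  \<comment> \<open>With the norm as a factor on the left, the relation is a polynomial identity in
    all variables.\<close>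
  have "mat (s^2 - Delta (B, C) * k^2) = mat2 (s^2 - Delta (B, C) * k^2) 0 0 (s^2 - Delta (B, C) * k^2)"
    by (simp add: vec_eq_iff forall_2 mat_def)
  then have "mat (s^2 - Delta (B, C) * k^2) ** (axis_mat B C s k ** ell_mat B C b u) =
      ell_mat B C b' u' ** axis_mat B C s k"
    unfolding axis_mat_def ell_mat_def mat2_mult mat2_eq_iff Delta_pair b' u'
    by (simp only: mat2_mult mat2_eq_iff) (simp add: algebra_simps power2_eq_square)
  with assms(1) show ?thesis
    by simp
qed

lemma norm_identity:
  "(3 * b - 2 * (B + C) * u)^2 - 4 * u^2 * Delta (B, C) =
     3 * (3 * b^2 - 4 * (B + C) * b * u + 4 * B * C * u^2)"
  unfolding Delta_pair by algebra

lemma form_identity: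
  fixes b B C u :: int
  shows "3 * b^2 - 4 * (B + C) * b * u + 4 * B * C * u^2 = 4 * (b - B * u) * (b - C * u) - b^2"
  by algebra

lemma on_axis_norm:
  assumes "on_axis B C (b, u)"
  shows "(3 * b - 2 * (B + C) * u)^2 - 4 * u^2 * Delta (B, C) = 9"
  using assms unfolding norm_identity by (simp add: on_axis_def)

text \<open>The identity 4 \<Delta> = (2 B - C)^2 + 3 C^2 compares t^2 with ((2 B - C) u)^2.\<close>

lemma abs_less_by_norm:
  fixes B C t u :: int
  assumes "t^2 - 4 * u^2 * Delta (B, C) = 9"
  shows "\<bar>(2 * B - C) * u\<bar> < \<bar>t\<bar>"
proof -
  have "4 * u^2 * Delta (B, C) = ((2 * B - C) * u)^2 + 3 * (C * u)^2"
    unfolding Delta_pair by algebra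
  then have "t^2 = ((2 * B - C) * u)^2 + 3 * (C * u)^2 + 9"
    using assms by linarith
  then have "((2 * B - C) * u)^2 < t^2"
    by (smt (verit) zero_le_power2)
  then show ?thesis
    by (metis abs_le_square_iff not_le)
qed

text \<open>Since 3 (b - C u) = t + (2 B - C) u and the last term is smaller than t in absolute
  value, both sides have the same sign. The form of the rotation is thus positive definite.\<close>

lemma on_axis_iff:
  "on_axis B C (b, u) \<longleftrightarrow> 3 * b^2 - 4 * (B + C) * b * u + 4 * B * C * u^2 = 3 \<and> b - C * u > 0"
proof (cases "3 * b^2 - 4 * (B + C) * b * u + 4 * B * C * u^2 = 3")
  case True
  define t where "t = 3 * b - 2 * (B + C) * u"
  have "t^2 - 4 * u^2 * Delta (B, C) = 9"
    using True unfolding t_def norm_identity by simp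
  define w where "w = (2 * B - C) * u"
  have "\<bar>w\<bar> < \<bar>t\<bar>"
    unfolding w_def by (rule abs_less_by_norm) fact
  moreover have "3 * (b - C * u) = t + w"
    by (simp add: t_def w_def algebra_simps)
  ultimately have "t > 0 \<longleftrightarrow> b - C * u > 0"
    by (smt (verit))
  with True show ?thesis by (simp add: on_axis_def t_def)
qed (simp add: on_axis_def)

section \<open>The correspondence between orbit points on the axis and pairs with a conjugate
  axis\<close>

locale axis_pair =
  fixes B C :: int
  assumes B_pos: "B > 0" and C_pos: "C > 0" and coprime: "coprime B C"
    and nonsquare: "\<not> is_square (Delta (B, C))"
begin

text \<open>Some g conjugates \<open>rho_mat\<close> to the given rotation. Pulling N back along g
  gives a matrix anticommuting with \<open>rho_mat\<close>, hence another axis matrix, and a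
  rotation moves its vector into the sector.\<close>

lemma linked_exists:
  assumes "on_axis B C (b, u)"
  obtains B' C' where "axis_pair B' C'" "Delta (B', C') = Delta (B, C)"
    "linked (B, C) (b, u) (B', C')"
proof -
  have "4 * (b - B * u) * (b - C * u) = b^2 + 3" "b - C * u > 0"
    using assms form_identity[of b B C u] unfolding on_axis_iff by simp_all
  from elliptic_conj_rho_mat[OF this(2,1)] obtain g where
    g: "det g = 1" "g ** rho_mat = ell_mat B C b u ** g"
    unfolding ell_mat_def by blast
  define X where "X = adj2 g ** axis_mat B C 0 1 ** g"
  have gX: "g ** X = axis_mat B C 0 1 ** g"
    using g(1) by (simp add: X_def matrix_mul_assoc mult_adj2)
  have anti: "axis_mat B C 0 1 ** ell_mat B C b u = - (ell_mat B C b u ** axis_mat B C 0 1)"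
    unfolding axis_mat_def ell_mat_def mat2_mult mat2_eq_iff uminus_mat2
    by (intro conjI; algebra)
  have neg: "P ** (- Q) = - (P ** Q)" "(- P) ** Q = - (P ** Q)" for P Q :: "int^2^2"
    by (simp_all add: vec_eq_iff forall_2 matrix_matrix_mult_def sum_2)
  have "X ** rho_mat = adj2 g ** axis_mat B C 0 1 ** (g ** rho_mat)"
    by (simp add: X_def matrix_mul_assoc)
  also have "\<dots> = adj2 g ** (axis_mat B C 0 1 ** ell_mat B C b u) ** g"
    by (simp add: g(2) matrix_mul_assoc)
  also have "\<dots> = - (adj2 g ** ell_mat B C b u ** axis_mat B C 0 1 ** g)"
    by (simp add: anti neg matrix_mul_assoc)
  also have "adj2 g ** ell_mat B C b u = rho_mat ** adj2 g"
    using g by (rule intertwine_adj2)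
  also have "- (rho_mat ** adj2 g ** axis_mat B C 0 1 ** g) = - (rho_mat ** X)"
    by (simp add: X_def matrix_mul_assoc)
  finally obtain B1 C1 where X: "X = axis_mat B1 C1 0 1"
    by (rule anticommute_rho_mat)
  have "det X = det (axis_mat B C 0 1)"
    using arg_cong[OF gX, of det] g(1) by (simp add: det_mul)
  then have D1: "Delta (B1, C1) = Delta (B, C)"
    by (simp add: X det_axis_mat)
  \<comment> \<open>B and C are integer combinations of the entries of X, so a common divisor of B1
    and C1 divides both.\<close>
  have "coprime B1 C1"
  proof (rule coprimeI)
    fix r assume r: "r dvd B1" "r dvd C1"
    have "axis_mat B C 0 1 = g ** X ** adj2 g"
      using gX g(1) by (metis matrix_mul_assoc matrix_mul_rid mult_adj2)
    moreover obtain p q v w where "g = mat2 p q v w" by (rule mat2_exhaust[of g])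
    ultimately have "B = (p * (- (B1 - C1)) + q * C1) * (- q) + (p * B1 + q * (B1 - C1)) * p"
      "C = (v * (- (B1 - C1)) + w * C1) * w + (v * B1 + w * (B1 - C1)) * (- v)"
      unfolding X axis_mat_def by (simp_all add: mat2_mult adj2_mat2 mat2_eq_iff)
    moreover have "r dvd B1 - C1"
      using r by simp
    ultimately have "r dvd B" "r dvd C"
      using r by (simp_all only: dvd_add dvd_mult dvd_mult2 dvd_minus_iff)
    with coprime show "is_unit r"
      by (rule coprime_common_divisor)
  qed
  from rotation_exists[OF this] D1 nonsquare obtain B' C' h where
    h: "B' > 0" "C' > 0" "coprime B' C'" "Delta (B', C') = Delta (B, C)" "det h = 1"
      "h ** rho_mat = rho_mat ** h" "h ** X = axis_mat B' C' 0 1 ** h"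
    unfolding X by metis
  show thesis
  proof
    show "axis_pair B' C'"
      using h nonsquare by unfold_locales auto
    show "Delta (B', C') = Delta (B, C)" by fact
    have "(g ** adj2 h) ** rho_mat = ell_mat B C b u ** (g ** adj2 h)"
      using intertwine_trans intertwine_adj2 g h by metis
    moreover have "(g ** adj2 h) ** axis_mat B' C' 0 1 = axis_mat B C 0 1 ** (g ** adj2 h)"
      using intertwine_trans intertwine_adj2 gX h by metis
    moreover have "det (g ** adj2 h) = 1"
      using g h by (simp add: det_mul det_adj2)
    ultimately show "linked (B, C) (b, u) (B', C')"
      unfolding linked_def prod.case by blast
  qed
qed

text \<open>The point is g \<rho>: its rotation is the conjugate of \<open>rho_mat\<close> by g, and
  anticommutation with N puts it in the form \<open>ell_mat B C b u\<close>.\<close>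

lemma linked_onto:
  assumes "det g = 1" "g ** axis_mat B' C' 0 1 = axis_mat B C 0 1 ** g"
  obtains b u where "on_axis B C (b, u)" "linked (B, C) (b, u) (B', C')"
proof -
  obtain p q v w where g: "g = mat2 p q v w" by (rule mat2_exhaust[of g])
  have det: "p * w - q * v = 1"
    using assms(1) by (simp add: g det_mat2)
  \<comment> \<open>The entries b, -2 y, 2 z, -b of \<open>g ** rho_mat ** adj2 g\<close>.\<close>
  define b where "b = p * w + 2 * q * w + 2 * p * v + q * v"
  define y where "y = p^2 + p * q + q^2"
  define z where "z = v^2 + v * w + w^2"
  have "b^2 + 3 * (p * w - q * v)^2 = 4 * y * z"
    unfolding b_def y_def z_def by algebra
  then have norm: "b^2 + 3 = 4 * y * z"
    by (simp add: det)
  have rho: "g ** rho_mat = mat2 b (- 2 * y) (2 * z) (- b) ** g"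
    using det unfolding g rho_mat_def mat2_mult mat2_eq_iff b_def y_def z_def
    by (intro conjI; algebra)
  \<comment> \<open>Vanishing of the trace of the conjugated rotation times N, that is, their
    anticommutation.\<close>
  have "(B * (b - z)) = C * (b - y)"
  proof -
    have eqs: "v * q = w * p - 1" 
       "p * (C' - B') + q * C' = (C - B) * p + B * v"
       "p * B' + q * (B' - C') = (C - B) * q + B * w"
       "v * (C' - B') + w * C' = C * p + (B - C) * v"
       "v * B' + w * (B' - C') = C * q + (B - C) * w"
      using det assms(2) unfolding g axis_mat_def mat2_mult mat2_eq_iff by (auto simp: algebra_simps)
    show ?thesis
      using eqs det unfolding b_def y_def z_def by algebra
  qed
  then have "(b - y) * C = B * (b - z)"
    by (simp add: algebra_simps)
  then obtain u where u: "b - y = u * B" "b - z = u * C"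
    using coprime_proportional coprime B_pos by (metis less_irrefl)
  have "z > 0"
  proof -
    have "4 * z = (2 * v + w)^2 + 3 * w^2"
      unfolding z_def by algebra
    moreover have "w \<noteq> 0 \<or> v \<noteq> 0"
      using det by auto
    ultimately show ?thesis
      by (smt (verit) mult_eq_0_iff zero_eq_power2 zero_le_power2)
  qed
  show thesis
  proof
    have "y = b - B * u" "z = b - C * u"
      using u by (simp_all add: algebra_simps)
    then show "on_axis B C (b, u)"
      using norm \<open>z > 0\<close> form_identity[of b B C u] unfolding on_axis_iff by simp
    show "linked (B, C) (b, u) (B', C')"
      using assms rho \<open>y = b - B * u\<close> \<open>z = b - C * u\<close> unfolding linked_def ell_mat_def by auto
  qed
qed

text \<open>The two conjugating matrices differ by an element commuting with \<open>rho_mat\<close>,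
  to which \<open>rotation_unique\<close> applies.\<close>

lemma linked_unique:
  assumes "linked (B, C) x (B1, C1)" "linked (B, C) x (B2, C2)"
    and "B1 > 0" "C1 > 0" "B2 > 0" "C2 > 0"
  shows "B1 = B2 \<and> C1 = C2"
proof -
  obtain b u where x: "x = (b, u)" by (rule prod.exhaust)
  obtain g where g: "det g = 1" "g ** rho_mat = ell_mat B C b u ** g"
    "g ** axis_mat B1 C1 0 1 = axis_mat B C 0 1 ** g"
    using assms(1) by (auto simp: linked_def x)
  obtain h where h: "det h = 1" "h ** rho_mat = ell_mat B C b u ** h"
    "h ** axis_mat B2 C2 0 1 = axis_mat B C 0 1 ** h"
    using assms(2) by (auto simp: linked_def x)
  have "det (adj2 h ** g) = 1"
    using g h by (simp add: det_mul det_adj2)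
  from rotation_unique[OF assms(3-6) this intertwine_trans[OF g(2) intertwine_adj2[OF h(1,2)]]
      intertwine_trans[OF g(3) intertwine_adj2[OF h(1,3)]]]
  show ?thesis by simp
qed

text \<open>The two conjugating matrices differ by an element commuting with N, hence by some s + k
  N of norm 1.\<close>

lemma linked_same_orbit:
  assumes "linked (B, C) x q" "linked (B, C) x' q"
  shows "same_orbit B C x x'"
proof -
  obtain b u b' u' B1 C1 where x: "x = (b, u)" "x' = (b', u')" "q = (B1, C1)"
    by (metis surj_pair)
  obtain g where g: "det g = 1" "g ** rho_mat = ell_mat B C b u ** g"
    "g ** axis_mat B1 C1 0 1 = axis_mat B C 0 1 ** g"
    using assms(1) by (auto simp: linked_def x)
  obtain h where h: "det h = 1" "h ** rho_mat = ell_mat B C b' u' ** h"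
    "h ** axis_mat B1 C1 0 1 = axis_mat B C 0 1 ** h"
    using assms(2) by (auto simp: linked_def x)
  have det: "det (h ** adj2 g) = 1"
    using g h by (simp add: det_mul det_adj2)
  have "(h ** adj2 g) ** axis_mat B C 0 1 = axis_mat B C 0 1 ** (h ** adj2 g)"
    using intertwine_trans[OF intertwine_adj2[OF g(1,3)] h(3)] .
  then obtain s k where sk: "h ** adj2 g = axis_mat B C s k"
    using centralizer_axis_mat[OF coprime] B_pos by (metis less_irrefl)
  have unit: "s^2 - Delta (B, C) * k^2 = 1"
    using det by (simp add: sk det_axis_mat)
  have *: "axis_mat B C s k ** ell_mat B C b u = ell_mat B C b' u' ** axis_mat B C s k"
    using intertwine_trans[OF intertwine_adj2[OF g(1,2)] h(2)] by (simp add: sk)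
  obtain b1 u1 where 1: "(b1, u1) = unit_act B C (s^2 + Delta (B, C) * k^2) (s * k) (b, u)"
    by (metis surj_pair)
  have "ell_mat B C b1 u1 = ell_mat B C b' u'"
    using intertwine_unique[OF _ axis_mat_ell_mat[OF unit 1] *] det sk by simp
  then have eqs: "b1 = b'" "- 2 * (b1 - B * u1) = - 2 * (b' - B * u')"
    unfolding ell_mat_def mat2_eq_iff by blast+
  have "B * u1 = B * u'"
    using eqs(2) unfolding eqs(1) by simp
  then have "(b', u') = (b1, u1)"
    using B_pos eqs(1) by simp
  with 1 unit show ?thesis
    unfolding same_orbit_def x by auto
qed

lemma same_orbit_linked:
  assumes "linked (B, C) x q" "same_orbit B C x x'"
  shows "linked (B, C) x' q"
proof -
  obtain b u b' u' B1 C1 where x: "x = (b, u)" "x' = (b', u')" "q = (B1, C1)"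
    by (metis surj_pair)
  obtain g where g: "det g = 1" "g ** rho_mat = ell_mat B C b u ** g"
    "g ** axis_mat B1 C1 0 1 = axis_mat B C 0 1 ** g"
    using assms(1) by (auto simp: linked_def x)
  obtain s k where unit: "s^2 - Delta (B, C) * k^2 = 1"
    and x': "(b', u') = unit_act B C (s^2 + Delta (B, C) * k^2) (s * k) (b, u)"
    using assms(2) by (auto simp: same_orbit_def x)
  have "axis_mat B C s k ** axis_mat B C 0 1 = axis_mat B C 0 1 ** axis_mat B C s k"
    by (simp add: axis_mat_mult mult.commute)
  from intertwine_trans[OF g(3) this] intertwine_trans[OF g(2) axis_mat_ell_mat[OF unit x']]
  show ?thesis
    using g(1) unit unfolding linked_def x prod.case
    by (intro exI[of _ "axis_mat B C s k ** g"]) (simp add: det_mul det_axis_mat)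
qed

end

section \<open>Norm 9 and the action of the units\<close>

text \<open>x + p \<surd>E and y + q \<surd>E are totally positive, so their product is, and its
  rational part is positive.\<close>

lemma norm_form_pos:
  fixes E x y p q :: int
  assumes "E > 0" "x > 0" "y > 0" "x^2 > E * p^2" "y^2 > E * q^2"
  shows "x * y + E * (p * q) > 0"
proof -
  have "(E * (p * q))^2 = (E * p^2) * (E * q^2)"
    by algebra
  also have "\<dots> < x^2 * y^2"
    using assms by (intro mult_strict_mono') auto
  finally have "\<bar>E * (p * q)\<bar>^2 < (x * y)^2"
    by (simp add: power_mult_distrib)
  then have "\<bar>E * (p * q)\<bar> < x * y"
    by (rule power_less_imp_less_base) (use assms in simp)
  then show ?thesis by linarith
qed

lemma unit_act_norm:
  assumes "(b', u') = unit_act B C a c (b, u)"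
  shows "3 * b' - 2 * (B + C) * u' = (3 * b - 2 * (B + C) * u) * a + 4 * (u * c) * Delta (B, C)"
    and "u' = u * a + (3 * b - 2 * (B + C) * u) * c"
proof -
  have b': "b' = b * a - 4 * B * C * u * c + 2 * (B + C) * b * c"
    and u': "u' = u * a + (3 * b - 2 * (B + C) * u) * c"
    using assms by (simp_all add: unit_act_def)
  show "u' = u * a + (3 * b - 2 * (B + C) * u) * c" by fact
  show "3 * b' - 2 * (B + C) * u' = (3 * b - 2 * (B + C) * u) * a + 4 * (u * c) * Delta (B, C)"
    unfolding b' u' Delta_pair by algebra
qed

lemma unit_act_unit_act:
  "unit_act B C a' c' (unit_act B C a c x) =
     unit_act B C (a * a' + 4 * Delta (B, C) * (c * c')) (a * c' + c * a') x"
  by (cases x) (simp add: unit_act_def Delta_pair algebra_simps power2_eq_square)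

lemma unit_act_one: "unit_act B C 1 0 x = x"
  by (cases x) (simp add: unit_act_def)

lemma unit_act_inverse:
  assumes "a^2 - Delta (B, C) * (2 * c)^2 = 1"
  shows "unit_act B C a (- c) (unit_act B C a c x) = x"
proof -
  have "a * a + 4 * Delta (B, C) * (c * - c) = 1"
    using assms by (simp add: power2_eq_square)
  then show ?thesis
    by (simp add: unit_act_unit_act unit_act_one mult.commute)
qed

text \<open>Modulo 3 the new u is a multiple of the old one.\<close>

lemma dvd_snd_unit_act:
  assumes "3 dvd snd x"
  shows "3 dvd snd (unit_act B C a c x)"
  using assms by (cases x) (simp add: unit_act_def)

lemma dvd_snd_unit_act_iff:
  assumes "a^2 - Delta (B, C) * (2 * c)^2 = 1"
  shows "3 dvd snd (unit_act B C a c x) \<longleftrightarrow> 3 dvd snd x"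
  using dvd_snd_unit_act unit_act_inverse[OF assms] by metis

lemma same_orbit_dvd_iff:
  assumes "same_orbit B C x x'"
  shows "3 dvd snd x' \<longleftrightarrow> 3 dvd snd x"
proof -
  obtain s k where unit: "s^2 - Delta (B, C) * k^2 = 1"
    and x': "x' = unit_act B C (s^2 + Delta (B, C) * k^2) (s * k) x"
    using assms by (auto simp: same_orbit_def)
  have "(s^2 + Delta (B, C) * k^2)^2 - Delta (B, C) * (2 * (s * k))^2 = (s^2 - Delta (B, C) * k^2)^2"
    by algebra
  with unit show ?thesis
    unfolding x' by (intro dvd_snd_unit_act_iff) simp
qed

section \<open>Divisibility by 3 and the units as quotients of numbers of norm 9\<close>

context axis_pair
begin

lemma Delta_pos: "Delta (B, C) > 0"
proof -
  have "4 * Delta (B, C) = (2 * B - C)^2 + 3 * C^2"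
    unfolding Delta_pair by algebra
  moreover have "C^2 > 0"
    using C_pos by simp
  ultimately show ?thesis
    by (smt (verit) zero_le_power2)
qed

lemma on_axis_origin: "on_axis B C (1, 0)"
  by (simp add: on_axis_def)

lemma on_axis_unit_act:
  assumes "on_axis B C x" "a^2 - Delta (B, C) * (2 * c)^2 = 1" "a > 0"
  shows "on_axis B C (unit_act B C a c x)"
proof -
  obtain b u where x: "x = (b, u)" by (rule prod.exhaust)
  obtain b' u' where 1: "(b', u') = unit_act B C a c (b, u)"
    by (metis surj_pair)
  define t where "t = 3 * b - 2 * (B + C) * u"
  define t' where "t' = 3 * b' - 2 * (B + C) * u'"
  have t': "t' = t * a + 4 * (u * c) * Delta (B, C)" and u': "u' = u * a + t * c"
    using unit_act_norm[OF 1] by (simp_all add: t_def t'_def)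
  have norm: "t^2 - 4 * u^2 * Delta (B, C) = 9" and "t > 0"
    using assms(1) on_axis_norm by (simp_all add: x t_def on_axis_def)
  have "t'^2 - 4 * u'^2 * Delta (B, C) =
      (t^2 - 4 * u^2 * Delta (B, C)) * (a^2 - Delta (B, C) * (2 * c)^2)"
    unfolding t' u' by algebra
  then have "t'^2 - 4 * u'^2 * Delta (B, C) = 9"
    using norm assms(2) by simp
  moreover have "t * a + (4 * Delta (B, C)) * (u * c) > 0"
    using assms(2,3) norm \<open>t > 0\<close> Delta_pos by (intro norm_form_pos) (simp_all add: algebra_simps)
  then have "t' > 0"
    by (simp add: t' algebra_simps)
  ultimately show ?thesis
    using norm_identity[of b' B C u'] unfolding x 1[symmetric] by (simp add: on_axis_def t'_def)
qed

text \<open>The norm equation modulo 3 ties (B + C) b to u, and 3 dividing B + C would make 3 a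
  common divisor of B and C. This congruence makes quotients of such points integral.\<close>

lemma not_3_dvd_sum:
  assumes "on_axis B C (b, u)" "\<not> 3 dvd u"
  shows "\<not> 3 dvd B + C" "3 dvd B * C * u - (B + C) * b"
proof -
  have "4 * (u * (B * C * u - (B + C) * b)) = 3 * (1 - b^2)"
    using assms(1) unfolding on_axis_def prod.case by (simp add: algebra_simps power2_eq_square)
  then have "3 dvd 4 * (u * (B * C * u - (B + C) * b))"
    by simp
  then have "3 dvd u * (B * C * u - (B + C) * b)"
    by presburger
  then show *: "3 dvd B * C * u - (B + C) * b"
    using assms(2) by (simp add: prime_dvd_mult_iff)
  show "\<not> 3 dvd B + C"
  proof
    assume 3: "3 dvd B + C"
    then have "3 dvd B * C * u"
      using * by (metis dvd_diff_commute dvd_mult2 zdvd_zdiffD)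
    then have "3 dvd B \<or> 3 dvd C"
      using assms(2) by (simp add: prime_dvd_mult_iff)
    then have "3 dvd B" "3 dvd C"
      using 3 by (auto simp: dvd_add_right_iff dvd_add_left_iff)
    then have "is_unit (3::int)"
      using coprime coprime_common_divisor by blast
    then show False by simp
  qed
qed

text \<open>The quotient is (t' + 2 u' \<surd>\<Delta>) (t - 2 u \<surd>\<Delta>) / 9. Once 9
  divides the irrational coordinate, the norm 81 of the numerator forces 9 to divide the rational
  one.\<close>

lemma on_axis_quotient:
  assumes "on_axis B C x" "on_axis B C x'" "3 dvd snd x \<longleftrightarrow> 3 dvd snd x'"
  obtains a c where "a > 0" "a^2 - Delta (B, C) * (2 * c)^2 = 1" "x' = unit_act B C a c x"
proof -
  obtain b u b' u' where x: "x = (b, u)" "x' = (b', u')"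
    by (metis surj_pair)
  define t where "t = 3 * b - 2 * (B + C) * u"
  define t' where "t' = 3 * b' - 2 * (B + C) * u'"
  have norm: "t^2 - 4 * u^2 * Delta (B, C) = 9" "t'^2 - 4 * u'^2 * Delta (B, C) = 9"
    and pos: "t > 0" "t' > 0"
    using assms(1,2) on_axis_norm by (simp_all add: x t_def t'_def on_axis_def)
  have "9 dvd u' * t - t' * u"
  proof (cases "3 dvd u")
    case True
    with assms(3) obtain v v' where "u = 3 * v" "u' = 3 * v'"
      by (auto simp: x elim!: dvdE)
    then have "u' * t - t' * u = 9 * (v' * (b - 2 * (B + C) * v) - v * (b' - 2 * (B + C) * v'))"
      by (simp add: t_def t'_def algebra_simps)
    then show ?thesis by simp
  next
    case False
    with assms(3) have u': "\<not> 3 dvd u'"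
      by (simp add: x)
    \<comment> \<open>Eliminating B C between the congruences for both points leaves (B + C) (b' u -
      b u'), with B + C invertible modulo 3.\<close>
    have "3 dvd u' * (B * C * u - (B + C) * b) - u * (B * C * u' - (B + C) * b')"
      using not_3_dvd_sum(2) assms(1,2) False u' unfolding x by simp
    also have "u' * (B * C * u - (B + C) * b) - u * (B * C * u' - (B + C) * b') =
        (B + C) * (b' * u - b * u')"
      by algebra
    finally have "3 dvd b' * u - b * u'"
      using not_3_dvd_sum(1) assms(1) False unfolding x by (simp add: prime_dvd_mult_iff)
    then obtain m where m: "b' * u - b * u' = 3 * m" ..
    have "u' * t - t' * u = - (3 * (b' * u - b * u'))"
      by (simp add: t_def t'_def algebra_simps)
    then show ?thesis unfolding m by simp
  qed
  then obtain c where c: "u' * t - t' * u = 9 * c" ..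
  have "(t * t' - 4 * u * u' * Delta (B, C))^2 - 4 * Delta (B, C) * (u' * t - t' * u)^2 =
      (t^2 - 4 * u^2 * Delta (B, C)) * (t'^2 - 4 * u'^2 * Delta (B, C))"
    by algebra
  then have sq: "(t * t' - 4 * u * u' * Delta (B, C))^2 = 9^2 * (1 + 4 * Delta (B, C) * c^2)"
    unfolding norm c by (simp add: algebra_simps power2_eq_square)
  then have "9^2 dvd (t * t' - 4 * u * u' * Delta (B, C))^2"
    by simp
  then have "9 dvd t * t' - 4 * u * u' * Delta (B, C)"
    by (simp only: pow_divides_pow_iff pos2)
  then obtain a where a: "t * t' - 4 * u * u' * Delta (B, C) = 9 * a" ..
  have unit: "a^2 - Delta (B, C) * (2 * c)^2 = 1"
    using sq unfolding a by (simp add: power_mult_distrib)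
  have "t * t' + (4 * Delta (B, C)) * (u * (- u')) > 0"
    using norm pos Delta_pos by (intro norm_form_pos) (simp_all add: algebra_simps)
  then have "9 * a > 0"
    unfolding a[symmetric] by (simp add: algebra_simps)
  then have "a > 0" by simp
  obtain b1 u1 where 1: "(b1, u1) = unit_act B C a c (b, u)"
    by (metis surj_pair)
  have "9 * u1 = u * (9 * a) + t * (9 * c)"
    using unit_act_norm(2)[OF 1] by (simp add: t_def)
  also have "\<dots> = u' * (t^2 - 4 * u^2 * Delta (B, C))"
    unfolding a[symmetric] c[symmetric] by algebra
  finally have u1: "u1 = u'"
    unfolding norm by simp
  have "9 * (3 * b1 - 2 * (B + C) * u1) = t * (9 * a) + 4 * (u * (9 * c)) * Delta (B, C)"
    using unit_act_norm(1)[OF 1] by (simp add: t_def)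
  also have "\<dots> = t' * (t^2 - 4 * u^2 * Delta (B, C))"
    unfolding a[symmetric] c[symmetric] by algebra
  finally have "3 * b1 - 2 * (B + C) * u1 = t'"
    unfolding norm by simp
  then have "b1 = b'"
    by (simp add: t'_def u1)
  with 1 u1 \<open>a > 0\<close> unit show thesis
    by (intro that[of a c]) (simp_all add: x)
qed

text \<open>A number of norm 9 can be cancelled: multiplying by its conjugate recovers 9 (a - a')
  and 9 (c - c').\<close>

lemma on_axis_free:
  assumes "on_axis B C x" "unit_act B C a c x = unit_act B C a' c' x"
  shows "a = a' \<and> c = c'"
proof -
  obtain b u where x: "x = (b, u)" by (rule prod.exhaust)
  define t where "t = 3 * b - 2 * (B + C) * u"
  have norm: "t^2 - 4 * u^2 * Delta (B, C) = 9"
    using assms(1) on_axis_norm by (simp add: x t_def)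
  obtain b' u' where 1: "(b', u') = unit_act B C a c (b, u)"
    by (metis surj_pair)
  have 2: "(b', u') = unit_act B C a' c' (b, u)"
    using 1 assms(2) by (simp add: x)
  have eqs: "t * a + 4 * (u * c) * Delta (B, C) = t * a' + 4 * (u * c') * Delta (B, C)"
      "u * a + t * c = u * a' + t * c'"
    using unit_act_norm[OF 1] unit_act_norm[OF 2] by (simp_all add: t_def)
  have "(t^2 - 4 * u^2 * Delta (B, C)) * (a - a') =
      t * ((t * a + 4 * (u * c) * Delta (B, C)) - (t * a' + 4 * (u * c') * Delta (B, C)))
      - 4 * u * Delta (B, C) * ((u * a + t * c) - (u * a' + t * c'))"
    by algebra
  then have "a = a'"
    unfolding norm eqs by simp
  have "(t^2 - 4 * u^2 * Delta (B, C)) * (c - c') =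
      t * ((u * a + t * c) - (u * a' + t * c'))
      - u * ((t * a + 4 * (u * c) * Delta (B, C)) - (t * a' + 4 * (u * c') * Delta (B, C)))"
    by algebra
  then have "c = c'"
    unfolding norm eqs by simp
  with \<open>a = a'\<close> show ?thesis by simp
qed

text \<open>A solution (t, u) codes a point when t > 0 and 3 divides t + 2 (B + C) u. Since 3
  divides t^2 - (2 (B + C) u)^2, this can be arranged by changing signs of t and u.\<close>

lemma exists_on_axis_not_dvd_iff:
  "(\<exists>x. on_axis B C x \<and> \<not> 3 dvd snd x) \<longleftrightarrow> (\<exists>t u. t^2 - 4 * u^2 * Delta (B, C) = 9 \<and> gcd 3 u = 1)"
proof -
  have gcd: "gcd 3 u = 1 \<longleftrightarrow> \<not> 3 dvd u" for u :: int
    using prime_imp_coprime[of 3 u] by (auto simp: coprime_iff_gcd_eq_1[symmetric] coprime_absorb_left)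
  show ?thesis
  proof
    assume "\<exists>x. on_axis B C x \<and> \<not> 3 dvd snd x"
    then obtain b u where "on_axis B C (b, u)" "\<not> 3 dvd u"
      by auto
    with on_axis_norm gcd show "\<exists>t u. t^2 - 4 * u^2 * Delta (B, C) = 9 \<and> gcd 3 u = 1"
      by blast
  next
    assume "\<exists>t u. t^2 - 4 * u^2 * Delta (B, C) = 9 \<and> gcd 3 u = 1"
    then obtain t u where "t^2 - 4 * u^2 * Delta (B, C) = 9" "gcd 3 u = 1"
      by (elim exE conjE)
    with gcd have tu: "t^2 - 4 * u^2 * Delta (B, C) = 9" "\<not> 3 dvd u"
      by simp_all
    have "t^2 > 0"
      using tu(1) Delta_pos by (smt (verit) mult_nonneg_nonneg zero_le_power2)
    then have "\<bar>t\<bar> > 0" by simp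
    define r where "r = 2 * (B + C) * u"
    have "r^2 = 4 * u^2 * Delta (B, C) + 12 * (B * C * u^2)"
      unfolding r_def Delta_pair by algebra
    then have "\<bar>t\<bar>^2 - r^2 = 3 * (3 - 4 * (B * C * u^2))"
      using tu(1) by (simp add: algebra_simps)
    moreover have "\<bar>t\<bar>^2 - r^2 = (\<bar>t\<bar> - r) * (\<bar>t\<bar> + r)"
      by algebra
    ultimately have "3 dvd (\<bar>t\<bar> - r) * (\<bar>t\<bar> + r)"
      by (metis dvd_triv_left)
    then have "3 dvd \<bar>t\<bar> - r \<or> 3 dvd \<bar>t\<bar> + r"
      by (simp add: prime_dvd_mult_iff)
    then obtain v where v: "v = u \<or> v = - u" "3 dvd \<bar>t\<bar> + 2 * (B + C) * v"
    proof
      assume "3 dvd \<bar>t\<bar> - r"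
      then show thesis
        by (intro that[of "- u"]) (simp_all add: r_def algebra_simps)
    next
      assume "3 dvd \<bar>t\<bar> + r"
      then show thesis
        by (intro that[of u]) (simp_all add: r_def)
    qed
    then obtain b where b: "\<bar>t\<bar> + 2 * (B + C) * v = 3 * b" by auto
    have "v^2 = u^2"
      using v(1) by auto
    then have "(3 * b - 2 * (B + C) * v)^2 - 4 * v^2 * Delta (B, C) = 9"
      using tu(1) by (simp add: b[symmetric])
    then have "on_axis B C (b, v)"
      using \<open>\<bar>t\<bar> > 0\<close> unfolding norm_identity on_axis_def by (simp add: b[symmetric])
    moreover have "\<not> 3 dvd v"
      using v(1) tu(2) by auto
    ultimately show "\<exists>x. on_axis B C x \<and> \<not> 3 dvd snd x"
      by auto
  qed
qed

end

section \<open>Cardinality of the fibres\<close>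

locale axis_fundamental = axis_pair B C + min_pell "Delta (B, C)" s k for B C s k :: int
begin

text \<open>Phrased by conjugacy of the matrices N alone; \<open>fibre_eq\<close> identifies it with
  the fibre of \<open>phi\<close>.\<close>

definition fibre :: "(int \<times> int) set" where
  "fibre = {(B', C'). axis_pair B' C' \<and> Delta (B', C') = Delta (B, C) \<and>
     (\<exists>g. det g = 1 \<and> g ** axis_mat B' C' 0 1 = axis_mat B C 0 1 ** g)}"

definition target :: "int \<times> int \<Rightarrow> int \<times> int" where
  "target x = (SOME q. q \<in> fibre \<and> linked (B, C) x q)"

lemma target:
  assumes "on_axis B C x"
  shows "target x \<in> fibre" "linked (B, C) x (target x)"
proof -
  obtain b u where x: "x = (b, u)" by (rule prod.exhaust)
  obtain B' C' where q: "axis_pair B' C'" "Delta (B', C') = Delta (B, C)"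
    and l: "linked (B, C) (b, u) (B', C')"
    using linked_exists assms unfolding x by blast
  then have "(B', C') \<in> fibre"
    unfolding fibre_def linked_def by auto
  with l have "\<exists>q. q \<in> fibre \<and> linked (B, C) x q"
    unfolding x by blast
  then have "target x \<in> fibre \<and> linked (B, C) x (target x)"
    unfolding target_def by (rule someI_ex)
  then show "target x \<in> fibre" "linked (B, C) x (target x)"
    by simp_all
qed

lemma target_eqI:
  assumes "on_axis B C x" "linked (B, C) x q" "q \<in> fibre"
  shows "target x = q"
proof -
  obtain B1 C1 B2 C2 where q: "q = (B1, C1)" "target x = (B2, C2)"
    by (metis surj_pair)
  have "axis_pair B1 C1" "axis_pair B2 C2"
    using assms(3) target(1)[OF assms(1)] unfolding q fibre_def by auto
  then show ?thesis
    using linked_unique assms(2) target(2)[OF assms(1)] unfolding q axis_pair_def by blast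
qed

lemma target_eq_iff:
  assumes "on_axis B C x" "on_axis B C x'"
  shows "target x = target x' \<longleftrightarrow> same_orbit B C x x'"
proof
  assume "target x = target x'"
  then show "same_orbit B C x x'"
    using linked_same_orbit target(2)[OF assms(1)] target(2)[OF assms(2)] by metis
next
  assume "same_orbit B C x x'"
  then show "target x = target x'"
    using target_eqI assms target same_orbit_linked by metis
qed

lemma target_onto:
  assumes "q \<in> fibre"
  obtains x where "on_axis B C x" "target x = q"
proof -
  obtain B' C' g where q: "q = (B', C')" "det g = 1" "g ** axis_mat B' C' 0 1 = axis_mat B C 0 1 ** g"
    using assms unfolding fibre_def by auto
  obtain b u where "on_axis B C (b, u)" "linked (B, C) (b, u) (B', C')"
    by (rule linked_onto[OF q(2,3)])
  with assms show thesis
    using target_eqI that unfolding q by blast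
qed

text \<open>\<open>target\<close> induces a bijection from the orbits of points on the axis to the
  fibre.\<close>

lemma card_fibre_transversal:
  assumes "\<And>x. x \<in> R \<Longrightarrow> on_axis B C x"
    and "\<And>x y. x \<in> R \<Longrightarrow> y \<in> R \<Longrightarrow> same_orbit B C x y \<Longrightarrow> x = y"
    and "\<And>y. on_axis B C y \<Longrightarrow> \<exists>x\<in>R. same_orbit B C x y"
  shows "card fibre = card R"
proof -
  have "inj_on target R"
    using assms(1,2) target_eq_iff by (intro inj_onI) blast
  moreover have "target ` R = fibre"
  proof
    show "target ` R \<subseteq> fibre"
      using assms(1) target(1) by blast
    show "fibre \<subseteq> target ` R"
    proof
      fix q assume "q \<in> fibre"
      then obtain y where y: "on_axis B C y" "target y = q"
        by (rule target_onto)
      then obtain x where x: "x \<in> R" "same_orbit B C x y"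
        using assms(3) by blast
      then have "q = target x"
        using target_eq_iff[OF assms(1)[OF x(1)] y(1)] y(2) by simp
      with x(1) show "q \<in> target ` R" by blast
    qed
  qed
  ultimately show ?thesis
    using card_image by metis
qed

lemma same_orbit_odd:
  assumes "odd k" "on_axis B C x" "on_axis B C y" "3 dvd snd x \<longleftrightarrow> 3 dvd snd y"
  shows "same_orbit B C x y"
proof -
  obtain a c where "a > 0" "a^2 - Delta (B, C) * (2 * c)^2 = 1" "y = unit_act B C a c x"
    using on_axis_quotient[OF assms(2-4)] by metis
  with even_unit_square[OF assms(1)] show ?thesis
    unfolding same_orbit_def by metis
qed

context
  fixes l :: int
  assumes l: "k = 2 * l"
begin

lemma unit_l: "s^2 - Delta (B, C) * (2 * l)^2 = 1"
  using unit l by simp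

text \<open>The connecting unit is a square or the fundamental unit times a square; in the second
  case x is first multiplied by the fundamental unit.\<close>

lemma same_orbit_even:
  assumes "on_axis B C x" "on_axis B C y" "3 dvd snd x \<longleftrightarrow> 3 dvd snd y"
  shows "same_orbit B C x y \<or> same_orbit B C (unit_act B C s l x) y"
proof -
  obtain a c where ac: "a > 0" "a^2 - Delta (B, C) * (2 * c)^2 = 1" "y = unit_act B C a c x"
    using on_axis_quotient[OF assms] by metis
  obtain v w where vw: "v^2 - Delta (B, C) * w^2 = 1"
    and "a = v^2 + Delta (B, C) * w^2 \<and> c = v * w \<or>
      a = s * (v^2 + Delta (B, C) * w^2) + 4 * Delta (B, C) * l * (v * w) \<and>
      c = s * (v * w) + l * (v^2 + Delta (B, C) * w^2)"
    using even_unit_cases[OF l ac(2,1)] by blast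
  then show ?thesis
  proof (elim disjE conjE)
    assume "a = v^2 + Delta (B, C) * w^2" "c = v * w"
    with vw ac(3) show ?thesis
      unfolding same_orbit_def by metis
  next
    assume "a = s * (v^2 + Delta (B, C) * w^2) + 4 * Delta (B, C) * l * (v * w)"
      "c = s * (v * w) + l * (v^2 + Delta (B, C) * w^2)"
    then have "y = unit_act B C (v^2 + Delta (B, C) * w^2) (v * w) (unit_act B C s l x)"
      unfolding ac(3) unit_act_unit_act by (simp add: algebra_simps)
    with vw show ?thesis
      unfolding same_orbit_def by blast
  qed
qed

text \<open>The action is free, so equal orbits would make the fundamental unit a square.\<close>

lemma not_same_orbit_fundamental:
  assumes "on_axis B C x"
  shows "\<not> same_orbit B C x (unit_act B C s l x)"
proof
  assume "same_orbit B C x (unit_act B C s l x)"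
  then obtain v w where vw: "v^2 - Delta (B, C) * w^2 = 1"
    "unit_act B C s l x = unit_act B C (v^2 + Delta (B, C) * w^2) (v * w) x"
    unfolding same_orbit_def by blast
  from on_axis_free[OF assms vw(2)] have "k = 2 * (v * w)"
    using l by simp
  with fundamental_not_square[OF vw(1)] show False by simp
qed

end

lemma same_orbit_sym:
  assumes "on_axis B C x" "on_axis B C y" "same_orbit B C x y"
  shows "same_orbit B C y x"
  using target_eq_iff assms by metis

text \<open>The second factor counts the occurring values of the condition that 3 divides u, the
  first the orbits for each value.\<close>

lemma card_fibre:
  "card fibre = (if even k then 2 else 1) *
     (if \<exists>t u. t^2 - 4 * u^2 * Delta (B, C) = 9 \<and> gcd 3 u = 1 then 2 else 1)"
proof -
  define n :: nat where "n = (if \<exists>x. on_axis B C x \<and> \<not> 3 dvd snd x then 2 else 1)"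
  \<comment> \<open>One point for each occurring value of the condition; (1, 0) codes \<rho>
    itself.\<close>
  obtain T where T: "card T = n" "finite T" "\<And>x. x \<in> T \<Longrightarrow> on_axis B C x"
    and T_inj: "\<And>x y. x \<in> T \<Longrightarrow> y \<in> T \<Longrightarrow> 3 dvd snd x \<longleftrightarrow> 3 dvd snd y \<Longrightarrow> x = y"
    and T_cover: "\<And>y. on_axis B C y \<Longrightarrow> \<exists>x\<in>T. 3 dvd snd x \<longleftrightarrow> 3 dvd snd y"
  proof (cases "\<exists>x. on_axis B C x \<and> \<not> 3 dvd snd x")
    case True
    then obtain x where x: "on_axis B C x" "\<not> 3 dvd snd x" by blast
    then have "x \<noteq> (1, 0)" by auto
    with x True on_axis_origin show thesis
      by (intro that[of "{(1, 0), x}"]) (auto simp: n_def)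
  next
    case False
    with on_axis_origin show thesis
      by (intro that[of "{(1, 0)}"]) (auto simp: n_def)
  qed
  have "card fibre = (if even k then 2 else 1) * n"
  proof (cases "even k")
    case False
    have "card fibre = card T"
    proof (rule card_fibre_transversal)
      show "\<exists>x\<in>T. same_orbit B C x y" if "on_axis B C y" for y
        using T_cover[OF that] T(3) same_orbit_odd[OF False _ that] by blast
    qed (use T T_inj same_orbit_dvd_iff in blast)+
    with False T(1) show ?thesis by simp
  next
    case True
    then obtain l where l: "k = 2 * l" by auto
    let ?e = "unit_act B C s l"
    note unit_l = unit_l[OF l]
    have e_axis: "on_axis B C (?e x)" if "x \<in> T" for x
      using T(3)[OF that] unit_l s_pos by (rule on_axis_unit_act)
    have e_dvd: "3 dvd snd (?e x) \<longleftrightarrow> 3 dvd snd x" for x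
      using unit_l by (rule dvd_snd_unit_act_iff)
    have e_inj: "inj_on ?e T"
      using T_inj e_dvd by (intro inj_onI) metis
    have no: "\<not> same_orbit B C x (?e y)" "\<not> same_orbit B C (?e y) x" if "x \<in> T" "y \<in> T" for x y
    proof -
      show 1: "\<not> same_orbit B C x (?e y)"
      proof
        assume *: "same_orbit B C x (?e y)"
        then have "x = y"
          using same_orbit_dvd_iff e_dvd T_inj that by blast
        with * not_same_orbit_fundamental[OF l T(3)] that show False by blast
      qed
      then show "\<not> same_orbit B C (?e y) x"
        using same_orbit_sym T(3) e_axis that by blast
    qed
    have refl: "same_orbit B C x x" if "on_axis B C x" for x
      using target_eq_iff that by blast
    \<comment> \<open>For even k each value splits into the orbits of x and of its product with the
      fundamental unit.\<close>
    have "card fibre = card (T \<union> ?e ` T)"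
    proof (rule card_fibre_transversal)
      show "on_axis B C x" if "x \<in> T \<union> ?e ` T" for x
        using that T(3) e_axis by blast
      show "x = y" if "x \<in> T \<union> ?e ` T" "y \<in> T \<union> ?e ` T" "same_orbit B C x y" for x y
        using that(1)
      proof
        assume x: "x \<in> T"
        with that(2,3) no have "y \<in> T" by blast
        with x that(3) show ?thesis
          using T_inj same_orbit_dvd_iff by blast
      next
        assume "x \<in> ?e ` T"
        then obtain x' where x': "x' \<in> T" "x = ?e x'" by blast
        with that(2,3) no obtain y' where y': "y' \<in> T" "y = ?e y'" by blast
        have "x' = y'"
          using same_orbit_dvd_iff[OF that(3)] e_dvd T_inj x' y' by metis
        with x' y' show ?thesis by simp
      qed
      show "\<exists>x\<in>T \<union> ?e ` T. same_orbit B C x y" if "on_axis B C y" for y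
        using T_cover[OF that] T(3) same_orbit_even[OF l _ that] by blast
    qed
    also have "\<dots> = card T + card (?e ` T)"
      using T(2,3) no refl by (intro card_Un_disjoint) blast+
    finally show ?thesis
      using True T(1) e_inj by (simp add: card_image)
  qed
  then show ?thesis
    unfolding n_def exists_on_axis_not_dvd_iff by simp
qed

end

section \<open>Conjugacy in the modular group\<close>

context group
begin

lemma conj_class_subset:
  assumes "x \<in> carrier G" "y \<in> carrier G" "g \<in> carrier G" "g \<otimes> x = y \<otimes> g"
  shows "conj_class G x \<subseteq> conj_class G y"
proof
  fix z assume "z \<in> conj_class G x"
  then obtain a where a: "a \<in> carrier G" "z = a \<otimes> x \<otimes> inv a"
    by (auto simp: conj_class_def)
  have "x = inv g \<otimes> (y \<otimes> g)"
    using assms by (metis inv_solve_left m_closed)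
  then have "z = (a \<otimes> inv g) \<otimes> y \<otimes> inv (a \<otimes> inv g)"
    using a assms by (simp add: inv_mult_group m_assoc)
  then show "z \<in> conj_class G y"
    using a assms by (auto simp: conj_class_def)
qed

lemma conj_class_refl:
  assumes "x \<in> carrier G"
  shows "x \<in> conj_class G x"
  using assms by (auto simp: conj_class_def intro!: exI[of _ "\<one>"])

lemma mem_conj_classE:
  assumes "y \<in> conj_class G x" "x \<in> carrier G"
  obtains g where "g \<in> carrier G" "y \<in> carrier G" "g \<otimes> x = y \<otimes> g"
proof -
  obtain g where "g \<in> carrier G" "y = g \<otimes> x \<otimes> inv g"
    using assms(1) by (auto simp: conj_class_def)
  with assms(2) show thesis
    by (intro that[of g]) (simp_all add: m_assoc)
qed

lemma conj_class_eq_iff: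
  assumes "x \<in> carrier G" "y \<in> carrier G"
  shows "conj_class G x = conj_class G y \<longleftrightarrow> (\<exists>g\<in>carrier G. g \<otimes> x = y \<otimes> g)"
proof
  assume "conj_class G x = conj_class G y"
  then have "y \<in> conj_class G x"
    using conj_class_refl assms(2) by simp
  then show "\<exists>g\<in>carrier G. g \<otimes> x = y \<otimes> g"
    using mem_conj_classE assms(1) by metis
next
  assume "\<exists>g\<in>carrier G. g \<otimes> x = y \<otimes> g"
  then obtain g where g: "g \<in> carrier G" "g \<otimes> x = y \<otimes> g" by blast
  have "inv g \<otimes> y = x \<otimes> inv g"
    using g assms by (metis inv_closed inv_solve_left inv_solve_right m_assoc m_closed)
  then show "conj_class G x = conj_class G y"
    using conj_class_subset g assms inv_closed by (intro subset_antisym) metis+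
qed

text \<open>Conjugating an n-th root of x by g gives an n-th root of y.\<close>

lemma primitive_elt_conj:
  assumes "primitive_elt G y" "x \<in> carrier G" "conj_class G x = conj_class G y"
  shows "primitive_elt G x"
proof -
  have y: "y \<in> carrier G"
    using assms(1) by (simp add: primitive_elt_def)
  obtain g where g: "g \<in> carrier G" "g \<otimes> x = y \<otimes> g"
    using assms conj_class_eq_iff y by blast
  have "n < 2" if h: "h \<in> carrier G" "x = h [^] n" for h and n :: nat
  proof -
    have "g \<otimes> h [^] m = (g \<otimes> h \<otimes> inv g) [^] m \<otimes> g" for m :: nat
    proof (induction m)
      case (Suc m)
      have "g \<otimes> h [^] Suc m = (g \<otimes> h [^] m) \<otimes> h"
        using g h by (simp add: m_assoc)
      also have "\<dots> = (g \<otimes> h \<otimes> inv g) [^] m \<otimes> (g \<otimes> h)"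
        using g h by (simp add: Suc m_assoc)
      also have "g \<otimes> h = (g \<otimes> h \<otimes> inv g) \<otimes> g"
        using g h by (simp add: m_assoc)
      finally show ?case
        using g h by (simp add: m_assoc)
    qed (use g in simp)
    from this[of n] have "y \<otimes> g = (g \<otimes> h \<otimes> inv g) [^] n \<otimes> g"
      using g(2) h(2) by simp
    then have "y = (g \<otimes> h \<otimes> inv g) [^] n"
      using g h y by simp
    then show "n < 2"
      using assms(1) g h by (metis inv_closed m_closed not_le primitive_elt_def)
  qed
  then show ?thesis
    using assms(2) unfolding primitive_elt_def by (meson not_le)
qed

end

section \<open>Matrix representatives in the quotient by the centre\<close>

lemma carrier_SL2Z: "A \<in> carrier SL2Z \<longleftrightarrow> det A = 1"
  by (simp add: SL2Z_def)

lemma mult_SL2Z: "A \<otimes>\<^bsub>SL2Z\<^esub> B = A ** B"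
  by (simp add: SL2Z_def)

lemma one_SL2Z: "\<one>\<^bsub>SL2Z\<^esub> = mat 1"
  by (simp add: SL2Z_def)

lemma to_PSL2Z_eq: "to_PSL2Z A = {A, - A}"
proof -
  have "(- mat 1) ** A = - A"
    by (simp add: vec_eq_iff forall_2 matrix_matrix_mult_def sum_2 mat_def)
  then show ?thesis
    by (auto simp: to_PSL2Z_def r_coset_def SL2Z_center_def SL2Z_def)
qed

lemma to_PSL2Z_eq_iff: "to_PSL2Z A = to_PSL2Z B \<longleftrightarrow> A = B \<or> A = - B"
  unfolding to_PSL2Z_eq by (auto simp: doubleton_eq_iff)

lemma to_PSL2Z_hom: "group_hom SL2Z PSL2Z to_PSL2Z"
proof -
  have "to_PSL2Z \<in> hom SL2Z PSL2Z"
    using normal.r_coset_hom_Mod[OF normal_SL2Z_center] by (simp add: to_PSL2Z_def[abs_def] PSL2Z_def)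
  then show ?thesis
    by (simp add: group_hom_def group_hom_axioms_def group_SL2Z group_PSL2Z)
qed

interpretation to_PSL2Z: group_hom SL2Z PSL2Z to_PSL2Z
  by (rule to_PSL2Z_hom)

lemma carrier_PSL2Z: "carrier PSL2Z = to_PSL2Z ` {A. det A = 1}"
  unfolding PSL2Z_def carrier_FactGroup by (simp add: to_PSL2Z_def[abs_def] SL2Z_def)

lemma to_PSL2Z_carrier: "det A = 1 \<Longrightarrow> to_PSL2Z A \<in> carrier PSL2Z"
  by (simp add: carrier_PSL2Z)

lemma carrier_PSL2ZE:
  assumes "g \<in> carrier PSL2Z"
  obtains A where "det A = 1" "g = to_PSL2Z A"
  using assms by (auto simp: carrier_PSL2Z)

lemma to_PSL2Z_mult:
  "det A = 1 \<Longrightarrow> det B = 1 \<Longrightarrow> to_PSL2Z A \<otimes>\<^bsub>PSL2Z\<^esub> to_PSL2Z B = to_PSL2Z (A ** B)"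
  using to_PSL2Z.hom_mult[of A B] by (simp add: carrier_SL2Z mult_SL2Z)

lemma trace_intertwine:
  fixes g A B :: "int^2^2"
  assumes "det g = 1" "g ** A = B ** g"
  shows "trace A = trace B"
proof -
  have "A = adj2 g ** (B ** g)"
    using assms(1) by (simp add: adj2_mult matrix_mul_assoc flip: assms(2))
  then have "trace A = trace ((B ** g) ** adj2 g)"
    using trace_mul_sym[of "adj2 g" "B ** g"] by simp
  then show ?thesis
    using assms(1) by (simp add: mult_adj2 flip: matrix_mul_assoc)
qed

lemma conj_class_PSL2Z_eq_iff:
  assumes "det A = 1" "det B = 1"
  shows "conj_class PSL2Z (to_PSL2Z A) = conj_class PSL2Z (to_PSL2Z B) \<longleftrightarrow>
    (\<exists>g. det g = 1 \<and> (g ** A = B ** g \<or> g ** A = - (B ** g)))"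
proof -
  have "conj_class PSL2Z (to_PSL2Z A) = conj_class PSL2Z (to_PSL2Z B) \<longleftrightarrow>
      (\<exists>g. det g = 1 \<and> to_PSL2Z g \<otimes>\<^bsub>PSL2Z\<^esub> to_PSL2Z A = to_PSL2Z B \<otimes>\<^bsub>PSL2Z\<^esub> to_PSL2Z g)"
    using assms by (subst to_PSL2Z.H.conj_class_eq_iff) (auto simp: carrier_PSL2Z)
  then show ?thesis
    using assms by (auto simp: to_PSL2Z_mult to_PSL2Z_eq_iff)
qed

lemma trace_uminus: "trace (- A) = - trace (A :: int^2^2)"
  by (simp add: trace_def sum_2)

lemma det_uminus2: "det (- A) = det (A :: int^2^2)"
  by (simp add: det_2)

text \<open>Conjugation preserves the trace, so positive traces exclude the sign left open by the
  quotient.\<close>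

lemma conj_class_PSL2Z_eq_iff_pos_trace:
  assumes "det A = 1" "det B = 1" "trace A > 0" "trace B > 0"
  shows "conj_class PSL2Z (to_PSL2Z A) = conj_class PSL2Z (to_PSL2Z B) \<longleftrightarrow>
    (\<exists>g. det g = 1 \<and> g ** A = B ** g)"
proof -
  have False if "det g = 1" "g ** A = - (B ** g)" for g
  proof -
    have "g ** A = (- B) ** g"
      using that(2) by (simp add: vec_eq_iff forall_2 matrix_matrix_mult_def sum_2)
    then have "trace A = - trace B"
      using trace_intertwine[OF that(1)] trace_uminus by metis
    with assms show False by simp
  qed
  then show ?thesis
    unfolding conj_class_PSL2Z_eq_iff[OF assms(1,2)] by blast
qed

lemma hyperbolic_to_PSL2Z: "det A = 1 \<Longrightarrow> hyperbolic (to_PSL2Z A) \<longleftrightarrow> \<bar>trace A\<bar> > 2"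
  using to_PSL2Z_carrier[of A] by (auto simp: hyperbolic_def to_PSL2Z_eq trace_uminus)

lemma hyperbolic_conj:
  assumes "hyperbolic g" "h \<in> conj_class PSL2Z g"
  shows "hyperbolic h" "conj_class PSL2Z h = conj_class PSL2Z g"
proof -
  have g: "g \<in> carrier PSL2Z"
    using assms(1) by (simp add: hyperbolic_def)
  obtain x where x: "x \<in> carrier PSL2Z" "h \<in> carrier PSL2Z" "x \<otimes>\<^bsub>PSL2Z\<^esub> g = h \<otimes>\<^bsub>PSL2Z\<^esub> x"
    using to_PSL2Z.H.mem_conj_classE[OF assms(2) g] .
  then show "conj_class PSL2Z h = conj_class PSL2Z g"
    using to_PSL2Z.H.conj_class_eq_iff g by metis
  obtain A where A: "det A = 1" "g = to_PSL2Z A" using g by (rule carrier_PSL2ZE)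
  obtain B where B: "det B = 1" "h = to_PSL2Z B" using x(2) by (rule carrier_PSL2ZE)
  obtain y where y: "det y = 1" "y ** B = A ** y \<or> y ** B = - (A ** y)"
    using conj_class_PSL2Z_eq_iff[OF B(1) A(1)] \<open>conj_class PSL2Z h = conj_class PSL2Z g\<close> A B by blast
  have "- (A ** y) = (- A) ** y"
    by (simp add: vec_eq_iff forall_2 matrix_matrix_mult_def sum_2)
  then have "trace B = trace A \<or> trace B = - trace A"
    using y trace_intertwine[OF y(1)] trace_uminus by metis
  then show "hyperbolic h"
    using assms(1) A B by (auto simp: hyperbolic_to_PSL2Z)
qed

section \<open>Axes through \<open>\<rho>\<close>\<close>

lemma real_fixed_point_iff:
  assumes "a * d - b * c = 1"
  shows "real_fixed_point (mat2 a b c d) x \<longleftrightarrow>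
    of_int c * x^2 + of_int (d - a) * x - of_int b = 0"
proof -
  have "real_of_int (a * d - b * c) = 1"
    using assms by simp
  then have det: "real_of_int a * of_int d - of_int b * of_int c = 1"
    by simp
  \<comment> \<open>A zero denominator at a root makes the numerator vanish too, against determinant
    1.\<close>
  have nz: "of_int c * x + of_int d \<noteq> 0"
    if "of_int c * x^2 + of_int (d - a) * x - of_int b = 0"
  proof
    assume 0: "of_int c * x + of_int d = 0"
    have "x * (of_int c * x + of_int d) - (of_int a * x + of_int b) = 0"
      using that by (simp add: algebra_simps power2_eq_square)
    with 0 have "of_int a * x + of_int b = 0" by simp
    then have "of_int a * (of_int c * x + of_int d) - of_int c * (of_int a * x + of_int b) = 0"
      using 0 by simp
    then show False
      using det by (simp add: algebra_simps)
  qed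
  show ?thesis
  proof
    assume "real_fixed_point (mat2 a b c d) x"
    then have "of_int a * x + of_int b = x * (of_int c * x + of_int d)"
      by (auto simp: real_fixed_point_def divide_eq_eq)
    then show "of_int c * x^2 + of_int (d - a) * x - of_int b = 0"
      by (simp add: algebra_simps power2_eq_square)
  next
    assume q: "of_int c * x^2 + of_int (d - a) * x - of_int b = 0"
    then have "of_int a * x + of_int b = x * (of_int c * x + of_int d)"
      by (simp add: algebra_simps power2_eq_square)
    with nz[OF q] show "real_fixed_point (mat2 a b c d) x"
      by (simp add: real_fixed_point_def)
  qed
qed

lemma rho_eq: "rho = Complex (1 / 2) (sqrt 3 / 2)"
proof -
  have "rho = cis (pi / 3)"
    by (simp add: rho_def cis_conv_exp mult.commute)
  then show ?thesis
    by (simp add: complex_eq_iff cos_60 sin_60)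
qed

text \<open>With centre m = (x + y) / 2, the squared distance to \<rho> is m^2 - m + 1 and the
  squared radius is m^2 - x y.\<close>

lemma rho_mem_hyp_geodesic: "rho \<in> hyp_geodesic x y \<longleftrightarrow> 2 + 2 * (x * y) = x + y"
proof -
  define m where "m = (x + y) / 2"
  have "dist rho (of_real m) = sqrt ((1 / 2 - m)^2 + 3 / 4)"
    by (simp add: rho_eq dist_norm cmod_def power_divide)
  then have "rho \<in> hyp_geodesic x y \<longleftrightarrow> sqrt ((1 / 2 - m)^2 + 3 / 4) = \<bar>x - y\<bar> / 2"
    by (simp add: hyp_geodesic_def m_def rho_eq)
  also have "\<dots> \<longleftrightarrow> (1 / 2 - m)^2 + 3 / 4 = (\<bar>x - y\<bar> / 2)^2"
  proof -
    have "\<bar>x - y\<bar> / 2 = sqrt ((\<bar>x - y\<bar> / 2)^2)"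
      by (subst real_sqrt_abs) simp
    then show ?thesis
      by (metis real_sqrt_eq_iff)
  qed
  also have "(\<bar>x - y\<bar> / 2)^2 = (x - y)^2 / 4"
    by (simp add: power_divide)
  also have "(1 / 2 - m)^2 + 3 / 4 = (x - y)^2 / 4 \<longleftrightarrow> 2 + 2 * (x * y) = x + y"
    by (auto simp: m_def field_simps power2_eq_square)
  finally show ?thesis .
qed

text \<open>The fixed points are the roots of c z^2 + (d - a) z - b, so their sum is (a - d)/c and
  their product -b/c; the condition on \<rho> becomes linear in the entries.\<close>

lemma rho_mem_axis_mat2:
  assumes "a * d - b * c = 1" "\<bar>a + d\<bar> > 2"
  shows "(\<exists>x y. x \<noteq> y \<and> real_fixed_point (mat2 a b c d) x \<and> real_fixed_point (mat2 a b c d) y \<and>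
      rho \<in> hyp_geodesic x y) \<longleftrightarrow> a - d = 2 * (c - b)"
proof -
  note fix_iff = real_fixed_point_iff[OF assms(1)]
  have c: "c \<noteq> 0"
  proof
    assume "c = 0"
    with assms(1) have "a * d = 1" by simp
    then have "a = 1 \<and> d = 1 \<or> a = -1 \<and> d = -1"
      by (simp add: zmult_eq_1_iff)
    with assms(2) show False by auto
  qed
  show ?thesis
  proof
    assume "\<exists>x y. x \<noteq> y \<and> real_fixed_point (mat2 a b c d) x \<and> real_fixed_point (mat2 a b c d) y \<and>
      rho \<in> hyp_geodesic x y"
    then obtain x y :: real where "x \<noteq> y"
      and x: "of_int c * x^2 + of_int (d - a) * x - of_int b = 0"
      and y: "of_int c * y^2 + of_int (d - a) * y - of_int b = 0"
      and g: "2 + 2 * (x * y) = x + y"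
      unfolding fix_iff rho_mem_hyp_geodesic by blast
    have "(x - y) * (of_int c * (x + y) + of_int (d - a)) =
        (of_int c * x^2 + of_int (d - a) * x - of_int b) - (of_int c * y^2 + of_int (d - a) * y - of_int b)"
      by algebra
    also have "\<dots> = 0" by (simp only: x y)
    finally have sum: "of_int c * (x + y) + of_int (d - a) = 0"
      using \<open>x \<noteq> y\<close> by simp
    have "of_int c * x^2 + of_int (d - a) * x - of_int b =
        x * (of_int c * (x + y) + of_int (d - a)) - of_int c * (x * y) - of_int b"
      by algebra
    then have prod: "of_int c * (x * y) = - of_int b"
      unfolding x sum by simp
    have "of_int c * (2 + 2 * (x * y)) = of_int c * (x + y)"
      by (simp only: g)
    then have "2 * of_int c + 2 * (of_int c * (x * y)) = of_int c * (x + y)"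
      by (simp add: algebra_simps)
    then have "2 * real_of_int c - 2 * of_int b = of_int (a - d)"
      unfolding prod using sum by simp
    then have "real_of_int (2 * c - 2 * b) = of_int (a - d)"
      by simp
    then show "a - d = 2 * (c - b)"
      by (simp only: of_int_eq_iff) simp
  next
    assume ad: "a - d = 2 * (c - b)"
    \<comment> \<open>The discriminant of the fixed point equation, positive because the trace
      exceeds 2 in absolute value.\<close>
    define E :: real where "E = of_int ((a + d)^2 - 4)"
    have "(a + d)^2 > 2^2"
      using assms(2) abs_le_square_iff[of "a + d" 2] by simp
    then have E: "E > 0"
      unfolding E_def of_int_0_less_iff by simp
    have "(a + d)^2 - 4 = (a - d)^2 + 4 * b * c + 4 * (a * d - b * c - 1)"
      by (simp add: power2_eq_square algebra_simps)
    then have "(a + d)^2 - 4 = (a - d)^2 + 4 * b * c"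
      using assms(1) by simp
    then have "E = of_int ((a - d)^2 + 4 * b * c)"
      by (simp only: E_def)
    then have E2: "(sqrt E)^2 = (of_int a - of_int d)^2 + 4 * of_int b * of_int c"
      using E by simp
    define r where "r = sqrt E"
    have r: "r > 0" "r^2 = (of_int a - of_int d)^2 + 4 * of_int b * of_int c"
      using E E2 by (simp_all add: r_def)
    define C where "C = real_of_int c"
    have C: "C \<noteq> 0" using c by (simp add: C_def)
    define m where "m = real_of_int a - of_int d"
    have m: "m = 2 * (C - of_int b)"
      using arg_cong[OF ad, of real_of_int] by (simp add: m_def C_def)
    have r2: "r * r = m * m + 4 * of_int b * C"
      using r(2) by (simp add: m_def C_def power2_eq_square)
    define x where "x = (m + r) / (2 * C)"
    define y where "y = (m - r) / (2 * C)"
    have x: "2 * C * x = m + r" and y: "2 * C * y = m - r"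
      using C by (simp_all add: x_def y_def)
    have root: "C * z^2 - m * z - of_int b = 0" if "(2 * C * z - m)^2 = r * r" for z
    proof -
      have "4 * C * (C * z^2 - m * z - of_int b) = (2 * C * z - m)^2 - (m * m + 4 * of_int b * C)"
        by algebra
      also have "\<dots> = 0" using that r2 by simp
      finally show ?thesis using C by simp
    qed
    have "real_fixed_point (mat2 a b c d) x" "real_fixed_point (mat2 a b c d) y"
      using root[of x] root[of y] unfolding fix_iff x y
      by (simp_all add: power2_eq_square C_def m_def algebra_simps)
    moreover have "x \<noteq> y"
      using r(1) C by (simp add: x_def y_def)
    moreover have "2 + 2 * (x * y) = x + y"
    proof -
      have "4 * C * C * (x * y) = (2 * C * x) * (2 * C * y)" by algebra
      also have "\<dots> = 4 * C * (- of_int b)"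
        unfolding x y using r2 by (simp add: algebra_simps)
      finally have "4 * C * (C * (x * y)) = 4 * C * (- of_int b)"
        by (simp only: mult.assoc)
      then have "C * (x * y) = - of_int b"
        using C mult_left_cancel[of "4 * C"] by (metis mult_eq_0_iff zero_neq_numeral)
      moreover have "2 * (C * (x + y)) = 2 * m"
        using x y by (simp add: algebra_simps)
      ultimately have "C * (2 + 2 * (x * y)) = C * (x + y)"
        by (simp add: m algebra_simps)
      then show ?thesis using C by simp
    qed
    ultimately show "\<exists>x y. x \<noteq> y \<and> real_fixed_point (mat2 a b c d) x \<and>
        real_fixed_point (mat2 a b c d) y \<and> rho \<in> hyp_geodesic x y"
      unfolding rho_mem_hyp_geodesic by blast
  qed
qed

lemma rho_mem_axis_of_iff:
  assumes "a * d - b * c = 1" "\<bar>a + d\<bar> > 2"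
  shows "rho \<in> axis_of (to_PSL2Z (mat2 a b c d)) \<longleftrightarrow> a - d = 2 * (c - b)"
proof -
  have "rho \<in> axis_of (to_PSL2Z (mat2 a b c d)) \<longleftrightarrow>
      (\<exists>x y. x \<noteq> y \<and> real_fixed_point (mat2 a b c d) x \<and> real_fixed_point (mat2 a b c d) y \<and>
        rho \<in> hyp_geodesic x y) \<or>
      (\<exists>x y. x \<noteq> y \<and> real_fixed_point (mat2 (-a) (-b) (-c) (-d)) x \<and>
        real_fixed_point (mat2 (-a) (-b) (-c) (-d)) y \<and> rho \<in> hyp_geodesic x y)"
    unfolding axis_of_def to_PSL2Z_eq uminus_mat2 by blast
  also have "\<dots> \<longleftrightarrow> a - d = 2 * (c - b) \<or> -a - (-d) = 2 * (-c - (-b))"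
    using assms by (intro arg_cong2[of _ _ _ _ "(\<or>)"] rho_mem_axis_mat2) simp_all
  also have "\<dots> \<longleftrightarrow> a - d = 2 * (c - b)"
    by auto
  finally show ?thesis .
qed

lemma axis_mat_eqI:
  assumes "a - d = 2 * (c - b)"
  shows "mat2 a b c d = axis_mat b c (d + c - b) 1"
  using assms by (simp add: axis_mat_def mat2_eq_iff)

lemma rho_mem_axis_of_axis_mat:
  assumes "s^2 - Delta (B, C) * k^2 = 1" "\<bar>s\<bar> > 1"
  shows "rho \<in> axis_of (to_PSL2Z (axis_mat B C s k))"
proof -
  have "det (axis_mat B C s k) = 1"
    using assms(1) by (simp add: det_axis_mat)
  then show ?thesis
    using assms(2) unfolding axis_mat_def det_mat2
    by (subst rho_mem_axis_of_iff) (auto simp: algebra_simps)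
qed

section \<open>The parametrization\<close>

lemma pairs_rho_iff: "(B, C) \<in> pairs_rho \<longleftrightarrow> axis_pair B C"
  by (simp add: pairs_rho_def axis_pair_def)

lemma min_pell_exists:
  fixes D :: int
  assumes "D > 0" "\<not> is_square D"
  obtains s k where "min_pell D s k"
proof -
  define P where "P = (\<lambda>n::nat. n > 0 \<and> (\<exists>a::int. a^2 - D * (int n)^2 = 1))"
  obtain x y :: int where "y > 0" "x^2 - D * y^2 = 1"
    using pell_exists[OF assms] by metis
  then have "P (nat y)"
    by (auto simp: P_def)
  then have least: "P (LEAST n. P n)" "\<And>n. P n \<Longrightarrow> (LEAST n. P n) \<le> n"
    by (auto intro: LeastI Least_le)
  define k where "k = int (LEAST n. P n)"
  obtain a where a: "k > 0" "a^2 - D * k^2 = 1"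
    using least(1) by (auto simp: P_def k_def)
  have "k \<le> c" if "c > 0" "b^2 - D * c^2 = 1" for b c
  proof -
    have "P (nat c)"
      using that by (auto simp: P_def)
    from least(2)[OF this] that(1) show ?thesis
      by (simp add: k_def)
  qed
  moreover have "D * k^2 \<ge> 0"
    using assms(1) by simp
  then have "a \<noteq> 0"
    using a(2) by auto
  ultimately have "min_pell D \<bar>a\<bar> k"
    using a assms(1) by unfold_locales auto
  then show thesis by (rule that)
qed

section \<open>The minimal solution, and comparison of axis matrices through N\<close>

context min_pell
begin

text \<open>The equation forces T = 2 a and becomes a^2 - D k^2 = 1; there a grows with k, so the
  smallest k is smallest in both coordinates.\<close>

lemma min_pell_sol: "min_pell_sol D (2 * s, k)"
proof -
  have "pell_sol D (2 * s, k)"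
    using unit s_pos k_pos by (simp add: pell_sol_def power_mult_distrib algebra_simps)
  moreover have "2 * s \<le> T \<and> k \<le> l" if "pell_sol D (T, l)" for T l
  proof -
    have T: "T > 0" "l > 0" "T^2 - 4 * l^2 * D = 4"
      using that by (simp_all add: pell_sol_def)
    then have "T^2 = 4 * (1 + l^2 * D)" by simp
    then have "even (T^2)" by simp
    then obtain a where a: "T = 2 * a" by auto
    then have a2: "a^2 - D * l^2 = 1"
      using T(3) by (simp add: power_mult_distrib mult.commute)
    then have "k \<le> l"
      using minimal T(2) by blast
    then have "k^2 \<le> l^2"
      using k_pos by (intro power_mono) auto
    then have "D * k^2 \<le> D * l^2"
      using D_pos by simp
    then have "s^2 \<le> a^2"
      using a2 unit by linarith
    then have "s \<le> a"
      by (rule power2_le_imp_le) (use T(1) a in simp)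
    with \<open>k \<le> l\<close> a show ?thesis by simp
  qed
  ultimately show ?thesis
    by (auto simp: min_pell_sol_def)
qed

lemma min_pell_sol_unique:
  assumes "min_pell_sol D x"
  shows "x = (2 * s, k)"
  using assms min_pell_sol unfolding min_pell_sol_def
  by (metis order_antisym prod.collapse fst_conv snd_conv)

lemma the_min_sol: "the_min_sol D = (2 * s, k)"
  unfolding the_min_sol_def using min_pell_sol min_pell_sol_unique by (rule the_equality)

end

text \<open>In s + k N the scalar s commutes with g and the factor k cancels.\<close>

lemma intertwine_axis_mat_iff:
  assumes "k \<noteq> 0"
  shows "g ** axis_mat B' C' s k = axis_mat B C s k ** g \<longleftrightarrow>
    g ** axis_mat B' C' 0 1 = axis_mat B C 0 1 ** g"
proof -
  obtain a b c d where g: "g = mat2 a b c d" by (rule mat2_exhaust[of g])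
  define r where "r = (\<lambda>x y :: int. s * x + k * y)"
  have r: "r x y = r x z \<longleftrightarrow> y = z" for x y z
    using assms by (simp add: r_def)
  have l: "g ** axis_mat B' C' s k =
      mat2 (r a (- a * (B' - C') + b * C')) (r b (a * B' + b * (B' - C')))
        (r c (- c * (B' - C') + d * C')) (r d (c * B' + d * (B' - C')))"
    unfolding g axis_mat_def mat2_mult mat2_eq_iff r_def by (simp add: algebra_simps)
  have l': "axis_mat B C s k ** g =
      mat2 (r a (- a * (B - C) + B * c)) (r b (- b * (B - C) + B * d))
        (r c (C * a + c * (B - C))) (r d (C * b + d * (B - C)))"
    unfolding g axis_mat_def mat2_mult mat2_eq_iff r_def by (simp add: algebra_simps)
  show ?thesis
    unfolding l l' unfolding g axis_mat_def mat2_mult mat2_eq_iff r by (simp add: algebra_simps)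
qed

text \<open>The second coordinate grows at least linearly with the exponent, which excludes proper
  roots. Factoring out k leaves its sign free.\<close>

lemma axis_mat_pow:
  assumes "s^2 - Delta (B, C) * k^2 = 1" "s > 0" "Delta (B, C) > 0"
  shows "\<exists>a c. axis_mat B C s k [^]\<^bsub>SL2Z\<^esub> Suc n = axis_mat B C a (k * c) \<and> a > 0 \<and> c \<ge> int (Suc n)"
proof (induction n)
  case 0
  show ?case
    using assms(2) to_PSL2Z.G.nat_pow_Suc[of "axis_mat B C s k" 0]
    by (intro exI[of _ s] exI[of _ 1]) (simp add: mult_SL2Z one_SL2Z)
next
  case (Suc n)
  then obtain a c where ac: "axis_mat B C s k [^]\<^bsub>SL2Z\<^esub> Suc n = axis_mat B C a (k * c)"
    "a > 0" "c \<ge> int (Suc n)" by blast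
  have "axis_mat B C s k [^]\<^bsub>SL2Z\<^esub> Suc (Suc n) = axis_mat B C a (k * c) ** axis_mat B C s k"
    using ac(1) by (simp add: mult_SL2Z)
  also have "\<dots> = axis_mat B C (a * s + Delta (B, C) * (k^2 * c)) (k * (a + c * s))"
    by (simp add: axis_mat_mult algebra_simps power2_eq_square)
  finally have "axis_mat B C s k [^]\<^bsub>SL2Z\<^esub> Suc (Suc n) =
    axis_mat B C (a * s + Delta (B, C) * (k^2 * c)) (k * (a + c * s))" .
  moreover have "a * s + Delta (B, C) * (k^2 * c) > 0"
    using ac assms by (intro add_pos_nonneg) simp_all
  moreover have "c * s \<ge> c * 1"
    using ac(3) assms(2) by (intro mult_left_mono) auto
  then have "a + c * s \<ge> int (Suc (Suc n))"
    using ac(2,3) by linarith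
  ultimately show ?case by blast
qed

context axis_fundamental
begin

lemma det_axis: "det (axis_mat B C s k) = 1"
  using unit by (simp add: det_axis_mat)

lemma phi_mat_of_same_Delta:
  assumes "Delta (B', C') = Delta (B, C)"
  shows "phi_mat (B', C') = axis_mat B' C' s k"
  using assms by (simp add: phi_mat_def the_min_sol axis_mat_def)

lemma phi_eq: "phi (B, C) = conj_class PSL2Z (to_PSL2Z (axis_mat B C s k))"
  by (simp add: phi_def phi_mat_of_same_Delta)

text \<open>All pairs of norm \<Delta> share s and k, and both traces are 2 s > 0, so equal classes
  mean conjugate matrices N.\<close>

lemma fibre_eq: "{q \<in> pairs_at (Delta (B, C)). phi q = phi (B, C)} = fibre"
proof -
  have "(B', C') \<in> pairs_at (Delta (B, C)) \<and> phi (B', C') = phi (B, C) \<longleftrightarrow> (B', C') \<in> fibre" for B' C'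
  proof (cases "Delta (B', C') = Delta (B, C)")
    case True
    have "det (axis_mat B' C' s k) = 1"
      using unit True by (simp add: det_axis_mat)
    then have "phi (B', C') = phi (B, C) \<longleftrightarrow>
        (\<exists>g. det g = 1 \<and> g ** axis_mat B' C' s k = axis_mat B C s k ** g)"
      unfolding phi_def phi_mat_of_same_Delta[OF True] phi_mat_of_same_Delta[OF refl]
      using det_axis s_pos by (intro conj_class_PSL2Z_eq_iff_pos_trace) (simp_all add: trace_axis_mat)
    also have "\<dots> \<longleftrightarrow> (\<exists>g. det g = 1 \<and> g ** axis_mat B' C' 0 1 = axis_mat B C 0 1 ** g)"
      using k_pos intertwine_axis_mat_iff[of k] by simp
    finally show ?thesis
      using True by (simp add: pairs_at_def pairs_rho_iff fibre_def)
  qed (simp add: pairs_at_def fibre_def)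
  then show ?thesis by auto
qed

lemma s_gt_1: "s > 1"
proof -
  have "Delta (B, C) * k^2 > 0"
    using D_pos k_pos by simp
  then have "s^2 > 1^2"
    using unit by simp
  then show ?thesis
    using s_pos by (intro power_less_imp_less_base[of 1 2 s]) auto
qed

lemma hyperbolic_axis: "hyperbolic (to_PSL2Z (axis_mat B C s k))"
  using det_axis s_gt_1 by (simp add: hyperbolic_to_PSL2Z trace_axis_mat)

text \<open>A lift of an n-th root commutes with the fundamental matrix, hence has the form x + y N
  up to sign. For n \<ge> 2 its power has second coordinate at least 2 |y| in absolute value, while
  minimality gives k \<le> |y|.\<close>

lemma primitive_axis: "primitive_elt PSL2Z (to_PSL2Z (axis_mat B C s k))"
proof -
  let ?M = "axis_mat B C s k"
  have False if h: "h \<in> carrier PSL2Z" "n \<ge> 2" "to_PSL2Z ?M = h [^]\<^bsub>PSL2Z\<^esub> n" for h and n :: nat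
  proof -
    obtain H where H: "det H = 1" "h = to_PSL2Z H"
      using h(1) by (rule carrier_PSL2ZE)
    then have "to_PSL2Z ?M = to_PSL2Z (H [^]\<^bsub>SL2Z\<^esub> n)"
      using h(3) by (simp add: to_PSL2Z.hom_nat_pow carrier_SL2Z)
    then have pow: "H [^]\<^bsub>SL2Z\<^esub> n = ?M \<or> H [^]\<^bsub>SL2Z\<^esub> n = - ?M"
      by (auto simp: to_PSL2Z_eq_iff)
    have "H [^]\<^bsub>SL2Z\<^esub> n ** H = H ** H [^]\<^bsub>SL2Z\<^esub> n"
      using to_PSL2Z.G.nat_pow_Suc2[of H n] H(1) by (simp add: carrier_SL2Z mult_SL2Z)
    moreover have neg: "P ** (- Q) = - (P ** Q)" "(- P) ** Q = - (P ** Q)" for P Q :: "int^2^2"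
      by (simp_all add: vec_eq_iff forall_2 matrix_matrix_mult_def sum_2)
    ultimately have "H ** ?M = ?M ** H"
      using pow by auto
    then have "H ** axis_mat B C 0 1 = axis_mat B C 0 1 ** H"
      using intertwine_axis_mat_iff[of k H B C s B C] k_pos by simp
    then obtain x0 y0 where H0: "H = axis_mat B C x0 y0"
      using centralizer_axis_mat[OF coprime] B_pos by (metis less_irrefl)
    have unit0: "x0^2 - Delta (B, C) * y0^2 = 1"
      using H(1) by (simp add: H0 det_axis_mat)
    have "x0 \<noteq> 0"
      using unit0 D_pos by (smt (verit) mult_nonneg_nonneg zero_le_power2 zero_eq_power2)
    \<comment> \<open>The lift with positive trace, as the growth of the second coordinate
      requires.\<close>
    obtain x y where x: "x > 0" "h = to_PSL2Z (axis_mat B C x y)"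
      and unit': "x^2 - Delta (B, C) * y^2 = 1"
    proof (cases "x0 > 0")
      case True
      with that H H0 unit0 show thesis by blast
    next
      case False
      have "H = - axis_mat B C (- x0) (- y0)"
        by (simp add: H0 axis_mat_def uminus_mat2 mat2_eq_iff)
      then have "h = to_PSL2Z (axis_mat B C (- x0) (- y0))"
        by (simp add: H(2) to_PSL2Z_eq_iff)
      with that[of "- x0" "- y0"] False \<open>x0 \<noteq> 0\<close> unit0 show thesis by simp
    qed
    obtain n' where n': "n = Suc n'" "n' \<ge> 1"
      using h(2) by (cases n) auto
    obtain a c where ac: "axis_mat B C x y [^]\<^bsub>SL2Z\<^esub> n = axis_mat B C a (y * c)" "c \<ge> int n"
      using axis_mat_pow[OF unit' x(1) D_pos, of n'] n'(1) by blast
    have "det (axis_mat B C x y) = 1"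
      using unit' by (simp add: det_axis_mat)
    then have "to_PSL2Z ?M = to_PSL2Z (axis_mat B C x y [^]\<^bsub>SL2Z\<^esub> n)"
      using h(3) x(2) by (simp add: to_PSL2Z.hom_nat_pow carrier_SL2Z)
    then have "axis_mat B C s k = axis_mat B C a (y * c) \<or> axis_mat B C s k = - axis_mat B C a (y * c)"
      unfolding ac by (simp add: to_PSL2Z_eq_iff)
    then have "k * B = y * c * B \<or> k * B = - (y * c * B)"
      unfolding axis_mat_def uminus_mat2 mat2_eq_iff by blast
    then have "k = y * c \<or> k = - (y * c)"
      using B_pos by (metis mult_minus_left mult_right_cancel less_irrefl)
    then have "k = \<bar>y\<bar> * c"
      using k_pos ac(2) by (auto simp: abs_mult abs_if zero_less_mult_iff mult_less_0_iff)
    moreover have "y \<noteq> 0"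
      using calculation k_pos by auto
    moreover have "k \<le> \<bar>y\<bar>"
      using minimal[of "\<bar>y\<bar>" x] unit' \<open>y \<noteq> 0\<close> by simp
    moreover have "\<bar>y\<bar> * c \<ge> \<bar>y\<bar> * 2"
      using ac(2) h(2) by (intro mult_left_mono) auto
    ultimately show False by simp
  qed
  then show ?thesis
    using det_axis to_PSL2Z_carrier unfolding primitive_elt_def by blast
qed

lemma phi_mem_R_prim: "phi (B, C) \<in> R_prim"
proof -
  let ?g = "to_PSL2Z (axis_mat B C s k)"
  have "?g \<in> conj_class PSL2Z ?g"
    using det_axis by (intro to_PSL2Z.H.conj_class_refl to_PSL2Z_carrier)
  moreover have "rho \<in> axis_of ?g"
    using unit s_gt_1 by (intro rho_mem_axis_of_axis_mat) auto
  ultimately show ?thesis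
    unfolding phi_eq R_prim_def R_rho_def using hyperbolic_axis primitive_axis by blast
qed

text \<open>Sending a + b \<surd>\<Delta> to a + b N is multiplicative, so the descent on units
  becomes a statement on matrix powers.\<close>

lemma axis_mat_eq_pow:
  assumes "a^2 - Delta (B, C) * b^2 = 1" "a > 0" "b \<ge> 0"
  shows "\<exists>n::nat. axis_mat B C a b = axis_mat B C s k [^]\<^bsub>SL2Z\<^esub> n"
  using assms
proof (induction a b rule: unit_induct)
  case one
  have "axis_mat B C 1 0 = mat 1"
    by (simp add: axis_mat_def mat_1_mat2)
  then show ?case
    by (intro exI[of _ 0]) (simp add: one_SL2Z)
next
  case (step a b)
  then obtain n :: nat where n: "axis_mat B C a b = axis_mat B C s k [^]\<^bsub>SL2Z\<^esub> n" by blast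
  show ?case
    by (intro exI[of _ "Suc n"]) (simp add: mult_SL2Z axis_mat_mult flip: n)
qed

end

section \<open>Surjectivity onto the primitive classes\<close>

lemma axis_fundamental_exists:
  assumes "axis_pair B C"
  obtains s k where "axis_fundamental B C s k"
proof -
  interpret axis_pair B C by fact
  obtain s k where "min_pell (Delta (B, C)) s k"
    using min_pell_exists[OF Delta_pos nonsquare] .
  then show thesis
    using assms by (intro that[of s k]) (simp add: axis_fundamental_def)
qed

text \<open>A representative with axis through \<rho> is rotated so that its primitive vector lies
  in the sector. It is then a power of the fundamental matrix, and primitivity forces exponent
  1.\<close>

lemma R_prim_subset_range:
  assumes "c \<in> R_prim"
  obtains p where "p \<in> pairs_rho" "phi p = c"
proof -
  obtain g h where g: "hyperbolic g" "c = conj_class PSL2Z g" "h \<in> conj_class PSL2Z g" "rho \<in> axis_of h"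
    using assms by (auto simp: R_prim_def R_rho_def)
  obtain g' where g': "primitive_elt PSL2Z g'" "c = conj_class PSL2Z g'"
    using assms by (auto simp: R_prim_def)
  have h: "hyperbolic h" "conj_class PSL2Z h = c"
    using hyperbolic_conj[OF g(1,3)] g(2) by auto
  then obtain A where A: "det A = 1" "h = to_PSL2Z A"
    using carrier_PSL2ZE by (metis hyperbolic_def)
  obtain A' where A': "det A' = 1" "h = to_PSL2Z A'" "trace A' > 2"
  proof (cases "trace A > 0")
    case True
    with A h(1) that[of A] show thesis
      by (simp add: hyperbolic_to_PSL2Z)
  next
    case False
    with A h(1) that[of "- A"] show thesis
      by (simp add: hyperbolic_to_PSL2Z to_PSL2Z_eq_iff det_uminus2 trace_uminus)
  qed
  obtain a b c' d where abcd: "A' = mat2 a b c' d" by (rule mat2_exhaust[of A'])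
  have "a - d = 2 * (c' - b)"
    using g(4) A' rho_mem_axis_of_iff[of a d b c'] by (simp add: abcd det_mat2 trace_mat2)
  then obtain s where s: "A' = axis_mat b c' s 1"
    using axis_mat_eqI abcd by blast
  have "s > 1" "s^2 - Delta (b, c') = 1"
    using A' by (simp_all add: s trace_axis_mat det_axis_mat)
  \<comment> \<open>Dividing (b, c') by its gcd makes the vector primitive; r becomes the
    coefficient of N.\<close>
  define r where "r = gcd b c'"
  have "r \<noteq> 0"
  proof
    assume "r = 0"
    then have "Delta (b, c') = 0"
      by (simp add: r_def Delta_pair)
    then have "s^2 = 1^2" using \<open>s^2 - Delta (b, c') = 1\<close> by simp
    with \<open>s > 1\<close> show False by (simp add: power2_eq_1_iff)
  qed
  then have "r > 0" by (simp add: r_def)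
  define B0 where "B0 = b div r"
  define C0 where "C0 = c' div r"
  have bc: "b = r * B0" "c' = r * C0"
    by (simp_all add: B0_def C0_def r_def)
  have "coprime B0 C0"
    using \<open>r \<noteq> 0\<close> unfolding B0_def C0_def r_def by (intro div_gcd_coprime) auto
  have A0: "A' = axis_mat B0 C0 s r"
    unfolding s by (simp add: axis_mat_def mat2_eq_iff bc algebra_simps)
  have unit0: "s^2 - Delta (B0, C0) * r^2 = 1"
    using A'(1) by (simp add: A0 det_axis_mat)
  \<comment> \<open>For \<Delta> = m^2 the unit equation factors over the integers and leaves only s
    = 1 or s = -1.\<close>
  have "\<not> is_square (Delta (B0, C0))"
  proof
    assume "is_square (Delta (B0, C0))"
    then obtain m where "Delta (B0, C0) = m^2"
      by (auto elim: is_nth_powerE)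
    then have "(s - m * r) * (s + m * r) = 1"
      using unit0 by (simp add: algebra_simps power2_eq_square)
    then have "s - m * r = 1 \<and> s + m * r = 1 \<or> s - m * r = -1 \<and> s + m * r = -1"
      by (simp only: zmult_eq_1_iff)
    with \<open>s > 1\<close> show False by linarith
  qed
  from rotation_exists[OF \<open>coprime B0 C0\<close> this] obtain B C x where
    BC: "B > 0" "C > 0" "coprime B C" "Delta (B, C) = Delta (B0, C0)"
      "det x = 1" "x ** axis_mat B0 C0 0 1 = axis_mat B C 0 1 ** x"
    by metis
  have pair: "axis_pair B C"
    using BC \<open>\<not> is_square (Delta (B0, C0))\<close> by (simp add: axis_pair_def)
  then obtain S K where "axis_fundamental B C S K"
    by (rule axis_fundamental_exists)
  then interpret axis_fundamental B C S K .
  have "x ** A' = axis_mat B C s r ** x"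
    unfolding A0 intertwine_axis_mat_iff[OF \<open>r \<noteq> 0\<close>] by (rule BC(6))
  moreover have det: "det (axis_mat B C s r) = 1"
    using unit0 BC(4) by (simp add: det_axis_mat)
  ultimately have "conj_class PSL2Z (to_PSL2Z A') = conj_class PSL2Z (to_PSL2Z (axis_mat B C s r))"
    using conj_class_PSL2Z_eq_iff[OF A'(1) det] BC(5) by blast
  then have c: "c = conj_class PSL2Z (to_PSL2Z (axis_mat B C s r))"
    using h(2) A'(2) by simp
  have "primitive_elt PSL2Z (to_PSL2Z (axis_mat B C s r))"
    using to_PSL2Z.H.primitive_elt_conj[OF g'(1)] det to_PSL2Z_carrier c g'(2) by simp
  moreover obtain n :: nat where n: "axis_mat B C s r = axis_mat B C S K [^]\<^bsub>SL2Z\<^esub> n"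
    using axis_mat_eq_pow[of s r] unit0 BC(4) \<open>s > 1\<close> \<open>r > 0\<close> by auto
  then have "to_PSL2Z (axis_mat B C s r) = to_PSL2Z (axis_mat B C S K) [^]\<^bsub>PSL2Z\<^esub> n"
    using det_axis by (simp add: to_PSL2Z.hom_nat_pow carrier_SL2Z)
  ultimately have "n < 2"
    using det_axis to_PSL2Z_carrier unfolding primitive_elt_def by (meson not_le)
  moreover have "n \<noteq> 0"
  proof
    assume "n = 0"
    then have "axis_mat B C s r = mat 1"
      using n by (simp add: one_SL2Z)
    then have "r * B = 0"
      by (simp add: axis_mat_def mat_1_mat2 mat2_eq_iff)
    with \<open>r > 0\<close> BC(1) show False by simp
  qed
  ultimately have "n = Suc 0" by simp
  then have "axis_mat B C s r = axis_mat B C S K"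
    using n det_axis by (simp add: mult_SL2Z one_SL2Z)
  with c have "phi (B, C) = c"
    by (simp add: phi_eq)
  with pair show thesis
    by (intro that[of "(B, C)"]) (simp_all add: pairs_rho_iff)
qed

section \<open>Fibre sizes by the two parity conditions, and the final assembly\<close>

lemma n_to_one_onto_phi:
  assumes "even (snd (the_min_sol D)) \<longleftrightarrow> e1 = 0"
    and "(\<exists>t u :: int. t^2 - 4 * u^2 * D = 9 \<and> gcd 3 u = 1) \<longleftrightarrow> e2 = 0"
    and "n = (if e1 = (0::nat) then 2 else 1) * (if e2 = (0::nat) then 2 else 1)"
  shows "n_to_one_onto n phi (pairs_at D) (R_prim_at D)"
  unfolding n_to_one_onto_def
proof (intro conjI ballI)
  fix b assume "b \<in> R_prim_at D"
  then obtain B C where BC: "(B, C) \<in> pairs_rho" "Delta (B, C) = D" "b = phi (B, C)"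
    by (auto simp: R_prim_at_def pairs_at_def)
  have "axis_pair B C"
    using BC(1) by (simp add: pairs_rho_iff)
  then obtain s k where "axis_fundamental B C s k"
    by (rule axis_fundamental_exists)
  then interpret axis_fundamental B C s k .
  have "card {a \<in> pairs_at D. phi a = b} = card fibre"
    using fibre_eq BC by simp
  also have "\<dots> = n"
    using assms the_min_sol unfolding card_fibre BC(2) by simp
  finally show "card {a \<in> pairs_at D. phi a = b} = n" .
qed (simp add: R_prim_at_def)

theorem mainTheorem2:
  shows "(\<forall>p\<in>pairs_rho.
            (\<exists>!s. min_pell_sol (Delta p) s) \<and>
            even (fst (the_min_sol (Delta p))) \<and>
            phi_mat p \<in> carrier SL2Z \<and>
            phi p \<in> R_prim) \<and>
         phi ` pairs_rho = R_prim \<and>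
         (\<forall>D\<in>D_rho.
            (D \<in> D_rho_eps 1 1 \<longrightarrow> n_to_one_onto 1 phi (pairs_at D) (R_prim_at D)) \<and>
            (D \<in> D_rho_eps 1 0 \<or> D \<in> D_rho_eps 0 1 \<longrightarrow>
               n_to_one_onto 2 phi (pairs_at D) (R_prim_at D)) \<and>
            (D \<in> D_rho_eps 0 0 \<longrightarrow> n_to_one_onto 4 phi (pairs_at D) (R_prim_at D)))"
proof -
  have well_defined: "(\<exists>!s. min_pell_sol (Delta p) s) \<and> even (fst (the_min_sol (Delta p))) \<and>
      phi_mat p \<in> carrier SL2Z \<and> phi p \<in> R_prim" if "p \<in> pairs_rho" for p
  proof -
    obtain B C where p: "p = (B, C)" by (rule prod.exhaust)
    have "axis_pair B C"
      using that by (simp add: p pairs_rho_iff)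
    then obtain s k where "axis_fundamental B C s k"
      by (rule axis_fundamental_exists)
    then interpret axis_fundamental B C s k .
    have "\<exists>!s. min_pell_sol (Delta p) s"
      unfolding p using min_pell_sol min_pell_sol_unique by (rule ex1I)
    moreover have "phi_mat p \<in> carrier SL2Z"
      by (simp add: p carrier_SL2Z phi_mat_of_same_Delta det_axis)
    ultimately show ?thesis
      using phi_mem_R_prim the_min_sol by (simp add: p)
  qed
  have onto: "phi ` pairs_rho = R_prim"
  proof
    show "phi ` pairs_rho \<subseteq> R_prim"
      using well_defined by blast
    show "R_prim \<subseteq> phi ` pairs_rho"
      using R_prim_subset_range by (metis imageI subsetI)
  qed
  have count: "D \<in> D_rho_eps e1 e2 \<Longrightarrow>
      n_to_one_onto ((if e1 = 0 then 2 else 1) * (if e2 = 0 then 2 else 1)) phi (pairs_at D) (R_prim_at D)"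
    for D e1 e2
    by (intro n_to_one_onto_phi[of D e1 e2]) (auto simp: D_rho_eps_def)
  show ?thesis
    using count[of _ 1 1] count[of _ 1 0] count[of _ 0 1] count[of _ 0 0]
    by (intro conjI ballI impI well_defined onto) auto
qed

end
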